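(* Let $g,d\in\mathbb N$ and let $\mathcal Z$ be the set of $g$-partitioned unitaries with blocks of size $(2g^2+1)^d$. If a polynomial $f\in\mathbb C\langle X_{ij},X_{ij}^{\intercal}:1\le i,j\le g\rangle$ of degree $d-1$ is positive on $\mathcal Z$, then $$f\in\mathcal C_{2d}+(I_g-X^{\intercal}X,\,I_g-XX^{\intercal}).$$
   Context: $\mathbb C\langle X_{ij},X_{ij}^{\intercal}:1\le i,j\le g\rangle$ is the free associative unital $\mathbb C$-algebra in $2g^2$ freely noncommuting letters with the conjugate-linear involution ${}^{\intercal}$ (an antiautomorphism) exchanging $X_{ij}$ and $X_{ij}^{\intercal}$. $X=(X_{ij})_{ij}$ is the $g\times g$ matrix of letters, $X^{\intercal}$ is the $g\times g$ matrix with $(i,j)$ entry $(X_{ji})^{\intercal}$, and $(I_g-X^{\intercal}X,\,I_g-XX^{\intercal})$ is the two-sided ideal generated by the $2g^2$ entries of these matrices. A $g$-partitioned unitary with blocks of size $n$ is a $g^2$-tuple $A=(A_{ij})_{i,j=1}^g$ of matrices $A_{ij}\in M_n(\mathbb C)$ such that the $gn\times gn$ block matrix $A$ satisfies $A^*A=I$. The evaluation of $f$ at $A$ replaces $X_{ij}$ by $A_{ij}$ and $X_{ij}^{\intercal}$ by the conjugate transpose $A_{ij}^*$; $f$ is positive on $\mathcal Z$ if its evaluation at every $A\in\mathcal Z$ is a (Hermitian) positive semidefinite matrix. $\mathcal P_d$ is the subspace of polynomials of degree at most $d$, and $\mathcal C_{2d}=\operatorname{co}\{p^{\intercal}p: p\in\mathcal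 P_d\}$ (convex hull) is the convex cone of sums of Hermitian squares. *)

theory Defs
  imports "HOL-Analysis.Analysis" "HOL-Analysis.Finite_Function_Topology"
begin

text \<open>
  The number \<open>g\<close> is rendered by an index type \<open>'g::finite\<close> with \<open>CARD('g) = g\<close>, and the block
  size \<open>n\<close> by an index type \<open>'n::finite\<close>.  A matrix of size \<open>g * n\<close> is indexed by \<open>'g \<times> 'n\<close>.
\<close>

section \<open>The free algebra with involution\<close>

datatype 'g letter = X 'g 'g | XT 'g 'g

text \<open>
  The free monoid, written additively because \<^theory>\<open>HOL-Library.Poly_Mapping\<close> builds the monoid
  algebra (with the convolution product) over an additive, not necessarily commutative monoid.
\<close>

datatype 'a free_monoid = Word (letters: "'a list")

instantiation free_monoid :: (type) monoid_add
begin

definition zero_free_monoid :: "'a free_monoid"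
  where "0 = Word []"

definition plus_free_monoid :: "'a free_monoid \<Rightarrow> 'a free_monoid \<Rightarrow> 'a free_monoid"
  where "v + w = Word (letters v @ letters w)"

instance
  by standard (simp_all add: zero_free_monoid_def plus_free_monoid_def)

end

type_synonym 'g ncpoly = "'g letter free_monoid \<Rightarrow>\<^sub>0 complex"

definition gen :: "'g letter \<Rightarrow> 'g ncpoly"
  where "gen l = Poly_Mapping.single (Word [l]) 1"

fun star_letter :: "'g letter \<Rightarrow> 'g letter"
  where
    "star_letter (X i j) = XT i j"
  | "star_letter (XT i j) = X i j"

definition star_word :: "'g letter free_monoid \<Rightarrow> 'g letter free_monoid"
  where "star_word w = Word (rev (map star_letter (letters w)))"

definition ncstar :: "'g ncpoly \<Rightarrow> 'g ncpoly"
  where "ncstar p =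
    (\<Sum>w\<in>Poly_Mapping.keys p. Poly_Mapping.single (star_word w) (cnj (Poly_Mapping.lookup p w)))"

text \<open>The zero polynomial gets degree \<open>0\<close>.\<close>

definition ncdegree :: "'g ncpoly \<Rightarrow> nat"
  where "ncdegree p = Max (insert 0 ((\<lambda>w. length (letters w)) ` Poly_Mapping.keys p))"

definition polys_upto :: "nat \<Rightarrow> 'g ncpoly set"
  where "polys_upto d = {p. ncdegree p \<le> d}"

text \<open>\<open>sos_cone d\<close> is the cone written \<open>C\<^sub>2\<^sub>d\<close> in the literature: the index is half the degree.\<close>

definition sos_cone :: "nat \<Rightarrow> 'g ncpoly set"
  where "sos_cone d = convex hull {ncstar p * p | p. p \<in> polys_upto d}"


section \<open>The defining ideal\<close>

definition two_sided_ideal :: "'a::ring_1 set \<Rightarrow> bool"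
  where "two_sided_ideal J \<longleftrightarrow>
    0 \<in> J \<and> (\<forall>a\<in>J. \<forall>b\<in>J. a + b \<in> J) \<and> (\<forall>a\<in>J. \<forall>r. r * a \<in> J \<and> a * r \<in> J)"

definition Xmat :: "'g ncpoly ^ 'g ^ 'g"
  where "Xmat = (\<chi> i j. gen (X i j))"

definition XTmat :: "'g ncpoly ^ 'g ^ 'g"
  where "XTmat = (\<chi> i j. ncstar (gen (X j i)))"

definition entries :: "'a ^ 'm ^ 'k \<Rightarrow> 'a set"
  where "entries M = {M $ i $ j | i j. True}"

definition unitary_ideal :: "'g::finite ncpoly set"
  where "unitary_ideal = two_sided_ideal hull
    (entries (mat 1 - XTmat ** Xmat :: 'g ncpoly ^ 'g ^ 'g)
      \<union> entries (mat 1 - Xmat ** XTmat :: 'g ncpoly ^ 'g ^ 'g))"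


section \<open>Partitioned unitaries, evaluation and positivity\<close>

definition conj_transpose :: "complex ^ 'k ^ 'm \<Rightarrow> complex ^ 'm ^ 'k"
  where "conj_transpose M = map_matrix cnj (transpose M)"

definition psd :: "complex ^ 'n ^ 'n \<Rightarrow> bool"
  where "psd M \<longleftrightarrow>
    conj_transpose M = M \<and> (\<forall>v. 0 \<le> Re (\<Sum>r\<in>UNIV. cnj (v $ r) * (M *v v) $ r))"

definition block_matrix :: "('g::finite \<Rightarrow> 'g \<Rightarrow> complex ^ 'n ^ 'n) \<Rightarrow> complex ^ ('g \<times> 'n::finite) ^ ('g \<times> 'n)"
  where "block_matrix A = (\<chi> p q. A (fst p) (fst q) $ snd p $ snd q)"

definition partitioned_unitaries :: "('g::finite \<Rightarrow> 'g \<Rightarrow> complex ^ 'n ^ 'n) set"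
  where "partitioned_unitaries = {A. conj_transpose (block_matrix A) ** block_matrix A = mat 1}"

fun eval_letter :: "('g \<Rightarrow> 'g \<Rightarrow> complex ^ 'n ^ 'n) \<Rightarrow> 'g letter \<Rightarrow> complex ^ 'n ^ 'n"
  where
    "eval_letter A (X i j) = A i j"
  | "eval_letter A (XT i j) = conj_transpose (A i j)"

definition eval_word ::
    "('g \<Rightarrow> 'g \<Rightarrow> complex ^ 'n ^ 'n) \<Rightarrow> 'g letter free_monoid \<Rightarrow> complex ^ 'n ^ 'n"
  where "eval_word A w = foldr (\<lambda>l M. eval_letter A l ** M) (letters w) (mat 1)"

definition eval_poly :: "('g \<Rightarrow> 'g \<Rightarrow> complex ^ 'n ^ 'n) \<Rightarrow> 'g ncpoly \<Rightarrow> complex ^ 'n ^ 'n"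
  where "eval_poly A p =
    (\<Sum>w\<in>Poly_Mapping.keys p. map_matrix ((*) (Poly_Mapping.lookup p w)) (eval_word A w))"

definition positive_on ::
    "('g \<Rightarrow> 'g \<Rightarrow> complex ^ 'n ^ 'n) set \<Rightarrow> 'g ncpoly \<Rightarrow> bool"
  where "positive_on Z f \<longleftrightarrow> (\<forall>A\<in>Z. psd (eval_poly A f))"

end

theory Submission
  imports Defs
begin

text \<open>
  Write \<open>A\<close> for the quotient of the free algebra by \<^const>\<open>unitary_ideal\<close>, and \<open>P\<^sub>d\<close> for the
  polynomials of degree at most \<open>d\<close>.  The proof is a separation argument in which every functional
  that could separate \<open>f\<close> from the sums of squares is realised by a partitioned unitary of the
  prescribed size.

  \<^bold>\<open>From functionals to matrices.\<close>  A \<open>strict_state\<close> is a Hermitian functional \<open>l\<close> that vanishes on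
  the elements of the ideal of degree at most \<open>2d\<close> and is strictly positive on the squares
  \<open>p\<^sup>* p\<close> with \<open>p\<close> in \<open>P\<^sub>d\<close> but not in the ideal.  It makes \<open>P\<^sub>d\<close> modulo the ideal a Hilbert
  space; its dimension is at most the number of words of length at most \<open>d\<close>, hence at most
  \<open>(2g\<^sup>2 + 1)\<^sup>d\<close>.  The matrix \<open>X\<close> does not act on columns with entries in \<open>P\<^sub>d\<close>, since the degree
  would grow.  But the two partial assignments \<open>p \<mapsto> X p\<close> and \<open>X\<^sup>* p \<mapsto> p\<close>, for columns
  \<open>p\<close> with entries in \<open>P\<^sub>d\<^sub>-\<^sub>1\<close>, together preserve inner products: this is exactly what the relations
  \<open>X\<^sup>* X = 1\<close> and \<open>X X\<^sup>* = 1\<close> say.  An assignment between finite families of vectors with equal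
  Gram matrices extends to a unitary matrix (\<open>unitary_extension\<close>).  The blocks of that matrix
  form a partitioned unitary, and evaluating a polynomial of degree at most \<open>d\<close> at it and applying
  the result to the vector of \<open>1\<close> gives the vector of the polynomial (\<open>GNS_representation\<close>).  So
  positivity of \<open>f\<close> on the partitioned unitaries of this size gives \<open>l(f) \<ge> 0\<close> for every strict
  state, and it also makes \<open>f\<close> Hermitian modulo the ideal (\<open>hermitian_mod_ideal\<close>).

  \<^bold>\<open>From \<open>f\<close> to a functional.\<close>  Choose a basis of \<open>P\<^sub>d\<close> modulo the ideal that is orthonormal for
  one strict state.  Elements of degree at most \<open>2d\<close> are then represented, modulo the ideal, by
  complex matrices \<open>G\<close> through \<open>\<Sum> G\<^sub>k\<^sub>m b\<^sub>k\<^sup>* b\<^sub>m\<close>.  Let \<open>F\<close> represent \<open>f\<close>.  If the compact convex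
  hull of \<open>-F\<close> and of the rank one matrices \<open>x x\<^sup>*\<close> of unit vectors meets the subspace of matrices
  that represent elements of the ideal, then \<open>f\<close> is a sum of squares modulo the ideal
  (\<open>sos_if_hull_meets_null\<close>).  If not, a separating hyperplane is a strict state that is negative at
  \<open>f\<close> (\<open>state_if_hull_avoids_null\<close>), which the first part excludes.  Separating a compact set from a
  subspace avoids the question whether the cone of sums of squares is closed in the quotient.

  \<^bold>\<open>A first strict state.\<close>  Both parts need one strict state to start with, that is, enough
  positive functionals on \<open>A\<close>.  The \<open>g \<times> g\<close> matrices over \<open>A\<close> form the free product of the
  algebra \<open>M\<^sub>g\<close> of complex \<open>g \<times> g\<close> matrices with the group algebra of the integers, the generator of
  the latter being the matrix \<open>X\<close>.  A free product of two algebras with faithful traces acts on the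
  Hilbert space whose orthonormal basis consists of the reduced words in orthonormal bases of the two
  factors.  Here the generator permutes the words, and \<open>M\<^sub>g\<close> acts after an orthogonal change of
  coordinates.  To see that no information is lost, it is not necessary to know a basis of \<open>A\<close>: reading
  a reduced word as an element of the quotient defines a map back from the Hilbert space that
  commutes with the action modulo the ideal, so a polynomial that kills a component of the empty word lies in the ideal
  (\<open>act_root_faithful\<close>).
\<close>

section \<open>Scalars and linear functionals on the free algebra\<close>

definition cst :: "complex \<Rightarrow> 'g ncpoly"
  where "cst c = Poly_Mapping.single 0 c"

lemma poly_mapping_as_sum:
  fixes p :: "'a \<Rightarrow>\<^sub>0 'b::comm_monoid_add"
  shows "p = (\<Sum>w\<in>Poly_Mapping.keys p. Poly_Mapping.single w (Poly_Mapping.lookup p w))"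
  by (rule poly_mapping_eqI)
    (simp add: lookup_sum lookup_single when_def sum.delta' in_keys_iff)

lemma poly_mapping_additive_induct [case_names single add]:
  fixes p :: "'a \<Rightarrow>\<^sub>0 'b::comm_monoid_add"
  assumes single: "\<And>w c. P (Poly_Mapping.single w c)"
    and add: "\<And>p q. P p \<Longrightarrow> P q \<Longrightarrow> P (p + q)"
  shows "P p"
proof -
  have "P (\<Sum>w\<in>S. Poly_Mapping.single w (Poly_Mapping.lookup p w))" if "finite S" for S
    using that
  proof (induction S)
    case empty
    have "P (Poly_Mapping.single undefined 0)" by (rule single)
    then show ?case by simp
  next
    case (insert w S)
    then show ?case by (simp add: single add)
  qed
  from this[OF finite_keys, of p] show ?thesis
    using poly_mapping_as_sum[of p] by simp
qed

lemma cst_simps: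
  "cst 0 = 0" "cst 1 = 1" "cst (a + b) = cst a + cst b" "cst (a * b) = cst a * cst b"
  "cst (- a) = - cst a" "cst (a - b) = cst a - cst b"
  by (simp_all add: cst_def single_add mult_single single_uminus single_diff)

lemma cst_sum: "cst (sum a S) = (\<Sum>k\<in>S. cst (a k))"
  by (induction S rule: infinite_finite_induct) (simp_all add: cst_simps)

lemma cst_mult_single: "cst c * Poly_Mapping.single w a = Poly_Mapping.single w (c * a)"
  by (simp add: cst_def mult_single)

lemma cst_central: "p * cst c = cst c * p"
  by (induction p rule: poly_mapping_additive_induct)
    (simp_all add: cst_def mult_single algebra_simps)

lemma cst_left_commute: "p * (cst c * q) = cst c * (p * q)"
  by (metis cst_central mult.assoc)

lemma lookup_cst_mult: "Poly_Mapping.lookup (cst c * p) w = c * Poly_Mapping.lookup p w"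
  by (induction p rule: poly_mapping_additive_induct)
    (simp_all add: cst_mult_single lookup_single when_def lookup_add algebra_simps)

lemma scaleR_ncpoly: "r *\<^sub>R p = cst (of_real r) * (p :: 'g ncpoly)"
proof -
  have "finite {i. r *\<^sub>R Poly_Mapping.lookup p i \<noteq> 0}"
    by (rule finite_subset[of _ "Poly_Mapping.keys p"]) (auto simp: in_keys_iff)
  then show ?thesis
    by (intro poly_mapping_eqI)
      (simp add: scaleR_poly_mapping_def lookup_cst_mult scaleR_conv_of_real[where 'a=complex])
qed

definition lin :: "('a \<Rightarrow> complex) \<Rightarrow> ('a \<Rightarrow>\<^sub>0 complex) \<Rightarrow> complex"
  where "lin \<phi> p = (\<Sum>w\<in>Poly_Mapping.keys p. Poly_Mapping.lookup p w * \<phi> w)"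

lemma lin_single [simp]: "lin \<phi> (Poly_Mapping.single w c) = c * \<phi> w"
  by (simp add: lin_def)

lemma lin_add: "lin \<phi> (p + q) = lin \<phi> p + lin \<phi> q"
  unfolding lin_def by (rule setsum_keys_plus_distrib) (simp_all add: algebra_simps)

lemma lin_zero [simp]: "lin \<phi> 0 = 0"
  by (simp add: lin_def)

lemma lin_uminus: "lin \<phi> (- p) = - lin \<phi> p"
  by (metis lin_add lin_zero add.right_inverse add_eq_0_iff)

lemma lin_diff: "lin \<phi> (p - q) = lin \<phi> p - lin \<phi> q"
  using lin_add[of \<phi> p "- q"] by (simp add: lin_uminus)

lemma lin_sum: "lin \<phi> (sum p S) = (\<Sum>k\<in>S. lin \<phi> (p k))"
  by (induction S rule: infinite_finite_induct) (simp_all add: lin_add)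

lemma lin_cst_mult: "lin \<phi> (cst c * p) = c * lin \<phi> p"
  by (induction p rule: poly_mapping_additive_induct)
    (simp_all add: cst_mult_single lin_add algebra_simps)

section \<open>The involution and the degree\<close>

lemma ncstar_single: "ncstar (Poly_Mapping.single w c) = Poly_Mapping.single (star_word w) (cnj c)"
  by (simp add: ncstar_def)

lemma ncstar_zero [simp]: "ncstar 0 = 0"
  by (simp add: ncstar_def)

lemma ncstar_add: "ncstar (p + q) = ncstar p + ncstar q"
  unfolding ncstar_def
  by (rule setsum_keys_plus_distrib) (simp_all add: single_add)

lemma ncstar_uminus: "ncstar (- p) = - ncstar p"
  by (metis ncstar_add ncstar_zero add.right_inverse add_eq_0_iff)

lemma ncstar_diff: "ncstar (p - q) = ncstar p - ncstar q"
  using ncstar_add[of p "- q"] by (simp add: ncstar_uminus)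

lemma ncstar_sum: "ncstar (sum p S) = (\<Sum>k\<in>S. ncstar (p k))"
  by (induction S rule: infinite_finite_induct) (simp_all add: ncstar_add)

lemma star_word_plus: "star_word (v + w) = star_word w + star_word v"
  by (simp add: star_word_def plus_free_monoid_def)

lemma star_letter_star_letter [simp]: "star_letter (star_letter l) = l"
  by (cases l) simp_all

lemma star_word_star_word [simp]: "star_word (star_word w) = w"
  by (cases w) (simp add: star_word_def rev_map comp_def)

lemma star_word_zero [simp]: "star_word 0 = 0"
  by (simp add: star_word_def zero_free_monoid_def)

lemma ncstar_ncstar [simp]: "ncstar (ncstar p) = p"
  by (induction p rule: poly_mapping_additive_induct) (simp_all add: ncstar_single ncstar_add)

lemma ncstar_mult: "ncstar (p * q) = ncstar q * ncstar p"
proof (induction p rule: poly_mapping_additive_induct)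
  case (single v a)
  show ?case
    by (induction q rule: poly_mapping_additive_induct)
      (simp_all add: ncstar_single ncstar_add mult_single star_word_plus algebra_simps)
qed (simp add: ncstar_add algebra_simps)

lemma ncstar_cst: "ncstar (cst c) = cst (cnj c)"
  by (simp add: cst_def ncstar_single)

lemma ncstar_one [simp]: "ncstar 1 = 1"
  using ncstar_cst[of 1] by (simp add: cst_simps)

lemma ncstar_cst_mult: "ncstar (cst c * p) = cst (cnj c) * ncstar p"
  by (simp add: ncstar_mult ncstar_cst cst_central)

lemma ncstar_gen: "ncstar (gen l) = gen (star_letter l)"
  by (simp add: gen_def ncstar_single star_word_def)

lemma polys_upto_iff:
  "p \<in> polys_upto d \<longleftrightarrow> (\<forall>w\<in>Poly_Mapping.keys p. length (letters w) \<le> d)"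
  by (simp add: polys_upto_def ncdegree_def)

lemma polys_upto_mono: "p \<in> polys_upto d \<Longrightarrow> d \<le> e \<Longrightarrow> p \<in> polys_upto e"
  by (force simp: polys_upto_iff)

lemma polys_upto_zero [simp]: "0 \<in> polys_upto d"
  by (simp add: polys_upto_iff)

lemma polys_upto_add: "p \<in> polys_upto d \<Longrightarrow> q \<in> polys_upto d \<Longrightarrow> p + q \<in> polys_upto d"
  using keys_add[of p q] by (auto simp: polys_upto_iff)

lemma polys_upto_sum: "(\<And>k. k \<in> S \<Longrightarrow> p k \<in> polys_upto d) \<Longrightarrow> sum p S \<in> polys_upto d"
  by (induction S rule: infinite_finite_induct) (simp_all add: polys_upto_add)

lemma polys_upto_mult: "p \<in> polys_upto d \<Longrightarrow> q \<in> polys_upto e \<Longrightarrow> p * q \<in> polys_upto (d + e)"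
  using keys_mult[of p q] by (fastforce simp: polys_upto_iff plus_free_monoid_def)

lemma polys_upto_single: "length (letters w) \<le> d \<Longrightarrow> Poly_Mapping.single w c \<in> polys_upto d"
  by (simp add: polys_upto_iff)

lemma polys_upto_cst [simp]: "cst c \<in> polys_upto d"
  by (simp add: cst_def polys_upto_single zero_free_monoid_def)

lemma polys_upto_one [simp]: "1 \<in> polys_upto d"
  using polys_upto_cst[of 1 d] by (simp add: cst_simps)

lemma polys_upto_cst_mult: "p \<in> polys_upto d \<Longrightarrow> cst c * p \<in> polys_upto d"
  using polys_upto_mult[of "cst c" 0 p d] by simp

lemma polys_upto_uminus: "p \<in> polys_upto d \<Longrightarrow> - p \<in> polys_upto d"
  using polys_upto_cst_mult[of p d "-1"] by (simp add: cst_simps)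

lemma polys_upto_diff: "p \<in> polys_upto d \<Longrightarrow> q \<in> polys_upto d \<Longrightarrow> p - q \<in> polys_upto d"
  using polys_upto_add[of p d "- q"] polys_upto_uminus[of q d] by simp

lemma polys_upto_gen: "gen l \<in> polys_upto 1"
  by (simp add: gen_def polys_upto_single)

lemma polys_upto_ncstar: "p \<in> polys_upto d \<Longrightarrow> ncstar p \<in> polys_upto d"
  unfolding ncstar_def
  by (intro polys_upto_sum polys_upto_single) (simp add: polys_upto_iff star_word_def)

section \<open>The ideal\<close>

lemma two_sided_ideal_unitary_ideal: "two_sided_ideal unitary_ideal"
  unfolding unitary_ideal_def by (rule hull_in) (simp add: two_sided_ideal_def)

lemma
  shows ideal_zero [simp]: "0 \<in> unitary_ideal"
    and ideal_add: "p \<in> unitary_ideal \<Longrightarrow> q \<in> unitary_ideal \<Longrightarrow> p + q \<in> unitary_ideal"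
    and ideal_lmult: "p \<in> unitary_ideal \<Longrightarrow> r * p \<in> unitary_ideal"
    and ideal_rmult: "p \<in> unitary_ideal \<Longrightarrow> p * r \<in> unitary_ideal"
  using two_sided_ideal_unitary_ideal unfolding two_sided_ideal_def by blast+

lemma ideal_uminus: "p \<in> unitary_ideal \<Longrightarrow> - p \<in> unitary_ideal"
  using ideal_lmult[of p "-1"] by simp

lemma ideal_diff: "p \<in> unitary_ideal \<Longrightarrow> q \<in> unitary_ideal \<Longrightarrow> p - q \<in> unitary_ideal"
  using ideal_add[of p "- q"] ideal_uminus[of q] by simp

lemma ideal_sum: "(\<And>k. k \<in> S \<Longrightarrow> p k \<in> unitary_ideal) \<Longrightarrow> sum p S \<in> unitary_ideal"
  by (induction S rule: infinite_finite_induct) (simp_all add: ideal_add)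

lemma ideal_diff_trans:
  "p - q \<in> unitary_ideal \<Longrightarrow> q - r \<in> unitary_ideal \<Longrightarrow> p - r \<in> unitary_ideal"
  using ideal_add[of "p - q" "q - r"] by simp

lemma entry_XT_X:
    "(mat 1 - XTmat ** Xmat) $ i $ j = of_bool (i = j) - (\<Sum>k\<in>UNIV. gen (XT k i) * gen (X k j))"
  and entry_X_XT:
    "(mat 1 - Xmat ** XTmat) $ i $ j = of_bool (i = j) - (\<Sum>k\<in>UNIV. gen (X i k) * gen (XT j k))"
  by (simp_all add: mat_def matrix_matrix_mult_def XTmat_def Xmat_def ncstar_gen)

lemma unitary_ideal_minimal:
  assumes "two_sided_ideal J"
    and "\<And>i j. of_bool (i = j) - (\<Sum>k\<in>UNIV. gen (XT k i) * gen (X k j)) \<in> J"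
    and "\<And>i j. of_bool (i = j) - (\<Sum>k\<in>UNIV. gen (X i k) * gen (XT j k)) \<in> J"
  shows "unitary_ideal \<subseteq> J"
  unfolding unitary_ideal_def
proof (rule hull_minimal)
  show "entries (mat 1 - XTmat ** Xmat) \<union> entries (mat 1 - Xmat ** XTmat) \<subseteq> J"
    unfolding entries_def entry_XT_X entry_X_XT using assms(2,3) by blast
qed fact

lemma ideal_XT_X: "of_bool (i = j) - (\<Sum>k\<in>UNIV. gen (XT k i) * gen (X k j)) \<in> unitary_ideal"
  and ideal_X_XT: "of_bool (i = j) - (\<Sum>k\<in>UNIV. gen (X i k) * gen (XT j k)) \<in> unitary_ideal"
proof -
  have "entries (mat 1 - XTmat ** Xmat) \<union> entries (mat 1 - Xmat ** XTmat) \<subseteq> unitary_ideal"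
    unfolding unitary_ideal_def by (rule hull_subset)
  then show "of_bool (i = j) - (\<Sum>k\<in>UNIV. gen (XT k i) * gen (X k j)) \<in> unitary_ideal"
    and "of_bool (i = j) - (\<Sum>k\<in>UNIV. gen (X i k) * gen (XT j k)) \<in> unitary_ideal"
    unfolding entry_XT_X[symmetric] entry_X_XT[symmetric] entries_def by blast+
qed

text \<open>
  The set of elements whose adjoint lies in the ideal is a two-sided ideal, because the involution
  reverses products; it contains the generators, because the two relation matrices are Hermitian.
\<close>

lemma ideal_ncstar:
  fixes p :: "'g::finite ncpoly"
  assumes "p \<in> unitary_ideal"
  shows "ncstar p \<in> unitary_ideal"
proof -
  have "unitary_ideal \<subseteq> {p :: 'g ncpoly. ncstar p \<in> unitary_ideal}"
  proof (rule unitary_ideal_minimal)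
    show "two_sided_ideal {p. ncstar p \<in> unitary_ideal}"
      by (simp add: two_sided_ideal_def ncstar_add ncstar_mult ideal_add ideal_lmult ideal_rmult)
  next
    have star_bool: "ncstar (of_bool (i = j)) = of_bool (j = i)" for i j :: 'g
      by simp
    show "of_bool (i = j) - (\<Sum>k\<in>UNIV. gen (XT k i) * gen (X k j)) \<in> {p. ncstar p \<in> unitary_ideal}"
      and "of_bool (i = j) - (\<Sum>k\<in>UNIV. gen (X i k) * gen (XT j k)) \<in> {p. ncstar p \<in> unitary_ideal}"
      for i j :: 'g
      using ideal_XT_X[of j i] ideal_X_XT[of j i]
      by (simp_all only: mem_Collect_eq ncstar_diff ncstar_sum ncstar_mult ncstar_gen star_letter.simps
          star_bool)
  qed
  then show ?thesis using assms by blast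
qed

section \<open>Strictly positive functionals\<close>

text \<open>
  The ideal is tested only up to degree \<open>2d\<close>, because a functional that comes from separating Gram
  matrices over \<open>P\<^sub>d\<close> is controlled by the ideal only up to that degree.
\<close>

definition strict_state :: "nat \<Rightarrow> ('g::finite ncpoly \<Rightarrow> complex) \<Rightarrow> bool"
  where "strict_state d l \<longleftrightarrow>
    (\<forall>p q. l (p + q) = l p + l q) \<and> (\<forall>c p. l (cst c * p) = c * l p) \<and>
    (\<forall>p. l (ncstar p) = cnj (l p)) \<and>
    (\<forall>p\<in>unitary_ideal \<inter> polys_upto (2 * d). l p = 0) \<and>
    (\<forall>p\<in>polys_upto d - unitary_ideal. 0 < Re (l (ncstar p * p)))"

lemma strict_stateD:
  assumes "strict_state d l"
  shows "l (p + q) = l p + l q" "l (cst c * p) = c * l p" "l (ncstar p) = cnj (l p)"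
    "p \<in> unitary_ideal \<Longrightarrow> p \<in> polys_upto (2 * d) \<Longrightarrow> l p = 0"
    "p \<in> polys_upto d \<Longrightarrow> p \<notin> unitary_ideal \<Longrightarrow> 0 < Re (l (ncstar p * p))"
  using assms unfolding strict_state_def by blast+

lemma strict_state_zero: "strict_state d l \<Longrightarrow> l 0 = 0"
  using strict_stateD(1)[of d l 0 0] by simp

lemma strict_state_sum: "strict_state d l \<Longrightarrow> l (sum p S) = (\<Sum>k\<in>S. l (p k))"
  by (induction S rule: infinite_finite_induct) (simp_all add: strict_state_zero strict_stateD(1))

lemma strict_state_diff: "strict_state d l \<Longrightarrow> l (p - q) = l p - l q"
  using strict_stateD(1)[of d l "p - q" q] by simp

lemma strict_state_cnj: "strict_state d l \<Longrightarrow> l (ncstar q * p) = cnj (l (ncstar p * q))"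
  using strict_stateD(3)[of d l "ncstar p * q"] by (simp add: ncstar_mult)

text \<open>
  The degrees must be controlled here: \<open>l\<close> is only known to vanish on those elements of the ideal
  that have degree at most \<open>2d\<close>.
\<close>

lemma strict_state_ideal_right:
  assumes l: "strict_state d l" and "p - q \<in> unitary_ideal" "p \<in> polys_upto d" "q \<in> polys_upto d" "r \<in> polys_upto d"
  shows "l (ncstar r * p) = l (ncstar r * q)"
proof -
  have "ncstar r * (p - q) \<in> polys_upto (d + d)"
    using assms by (intro polys_upto_mult polys_upto_ncstar polys_upto_diff)
  then have "l (ncstar r * (p - q)) = 0"
    using assms(2) by (intro strict_stateD(4)[OF l] ideal_lmult) (simp_all add: mult_2)
  then show ?thesis by (simp add: right_diff_distrib strict_state_diff[OF l])
qed

section \<open>A unitary from a free product\<close>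

text \<open>
  The basis vectors of the free product are the reduced words, written as pairs \<open>(m, r)\<close>: a label
  \<open>m\<close> of an element \<open>b\<^sub>m\<close> of an orthonormal basis of the \<open>g \<times> g\<close> matrices, followed by a node \<open>r\<close>.  The
  node \<open>(m, n) # r\<close> stands for \<open>u\<^sup>n b\<^sub>m\<close> followed by \<open>r\<close>, where \<open>u\<close> is the unitary generator of the
  other factor.
\<close>

type_synonym 'g node = "(('g \<times> 'g) \<times> int) list"

definition supp :: "('a \<Rightarrow> 'b::zero) \<Rightarrow> 'a set"
  where "supp h = {x. h x \<noteq> 0}"

text \<open>
  This bilinear pairing serves two purposes.  With complex multiplication as \<open>sc\<close> it gives the inner
  product of finitely supported functions; with the scalar action on polynomials it is the linear
  extension of \<open>\<phi>\<close> from basis vectors.  Moving an operator from one side of the pairing to the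
  other thus proves both that the action respects adjoints and that the map back to the algebra is
  equivariant.
\<close>

definition pair :: "(complex \<Rightarrow> 'v \<Rightarrow> 'v) \<Rightarrow> ('a \<Rightarrow> 'v) \<Rightarrow> ('a \<Rightarrow> complex) \<Rightarrow> 'v::real_vector"
  where "pair sc \<phi> h = (\<Sum>x\<in>supp h. sc (h x) (\<phi> x))"

lemma pair_superset:
  assumes "bilinear sc" "finite S" "supp h \<subseteq> S"
  shows "pair sc \<phi> h = (\<Sum>x\<in>S. sc (h x) (\<phi> x))"
  unfolding pair_def using assms
  by (intro sum.mono_neutral_left) (auto simp: supp_def bilinear_lzero)

text \<open>
  The labels of the matrix basis are again pairs of indices.  The orthogonal matrix \<open>V\<close> relates this
  basis to the matrix units: \<open>b\<^sub>m\<close> is \<open>\<surd>g\<close> times the sum of \<open>V p m e\<^sub>p\<close> over all pairs \<open>p\<close>.  The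
  label \<open>(base, base)\<close> is reserved for the identity matrix, hence the form of its column.  The identity must
  be a basis element because it is shared by the two factors of the free product.
\<close>

locale rotation =
  fixes base :: "'g::finite" and V :: "'g \<times> 'g \<Rightarrow> 'g \<times> 'g \<Rightarrow> real"
  assumes rows: "(\<Sum>m\<in>UNIV. V p m * V q m) = of_bool (p = q)"
    and cols: "(\<Sum>p\<in>UNIV. V p m * V p n) = of_bool (m = n)"
    and base_col: "V (i, j) (base, base) = of_bool (i = j) / sqrt (of_nat CARD('g))"
begin

abbreviation id_label :: "'g \<times> 'g"
  where "id_label \<equiv> (base, base)"

text \<open>
  A word is not reduced if it contains \<open>u\<^sup>0\<close>, or the identity matrix between two powers of \<open>u\<close>; the
  identity is admitted as the last letter only, where it stands for the empty word.
\<close>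

fun reduced :: "'g node \<Rightarrow> bool"
  where
    "reduced [] = True"
  | "reduced ((m, n) # r) = (n \<noteq> 0 \<and> reduced r \<and> (m \<noteq> id_label \<or> r = []))"

text \<open>
  Left multiplication by \<open>u\<close> (for \<open>e = 1\<close>) and by its inverse (for \<open>e = -1\<close>).  A word whose label is
  the identity and whose node is not empty begins with a power of \<open>u\<close>, whose exponent changes by \<open>e\<close> and
  which disappears when the exponent becomes \<open>0\<close>.  Words that are not reduced are fixed, so that
  the map is a bijection of the whole type.
\<close>

fun shift :: "int \<Rightarrow> ('g \<times> 'g) \<times> 'g node \<Rightarrow> ('g \<times> 'g) \<times> 'g node"
  where
    "shift e (m, r) =
      (if \<not> reduced r then (m, r)
       else if m \<noteq> id_label then (id_label, (m, e) # r)
       else case r of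
         [] \<Rightarrow> (id_label, (m, e) # r)
       | (m', n) # r' \<Rightarrow> if n = - e then (m', r') else (id_label, (m', n + e) # r'))"

declare shift.simps [simp del]

lemma shift_inverse: "e \<noteq> 0 \<Longrightarrow> shift (- e) (shift e x) = x"
  by (cases x) (auto simp: shift.simps split: list.splits)

text \<open>
  The passage from coordinates in the basis \<open>b\<close> to coordinates in the matrix units, and its inverse
  (\<open>unrot\<close>).
\<close>

definition rot :: "(('g \<times> 'g) \<times> 'r \<Rightarrow> 'v::real_vector) \<Rightarrow> ('g \<times> 'g) \<times> 'r \<Rightarrow> 'v"
  where "rot k = (\<lambda>(p, r). \<Sum>m\<in>UNIV. V p m *\<^sub>R k (m, r))"

definition unrot :: "(('g \<times> 'g) \<times> 'r \<Rightarrow> 'v::real_vector) \<Rightarrow> ('g \<times> 'g) \<times> 'r \<Rightarrow> 'v"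
  where "unrot k = (\<lambda>(m, r). \<Sum>p\<in>UNIV. V p m *\<^sub>R k (p, r))"

lemma rot_unrot:
  fixes k :: "('g \<times> 'g) \<times> 'r \<Rightarrow> 'v::real_vector"
  shows "rot (unrot k) = k"
proof
  fix x :: "('g \<times> 'g) \<times> 'r"
  obtain p r where x: "x = (p, r)" by (cases x)
  have "rot (unrot k) x = (\<Sum>m\<in>UNIV. \<Sum>q\<in>UNIV. (V p m * V q m) *\<^sub>R k (q, r))"
    by (simp add: x rot_def unrot_def scaleR_sum_right)
  also have "\<dots> = (\<Sum>q\<in>UNIV. of_bool (p = q) *\<^sub>R k (q, r))"
    by (subst sum.swap) (simp add: scaleR_sum_left[symmetric] rows)
  also have "\<dots> = k x" by (simp add: x of_bool_def if_distrib[where f="\<lambda>c. c *\<^sub>R _"] cong: if_cong)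
  finally show "rot (unrot k) x = k x" .
qed

lemma unrot_rot:
  fixes k :: "('g \<times> 'g) \<times> 'r \<Rightarrow> 'v::real_vector"
  shows "unrot (rot k) = k"
proof
  fix x :: "('g \<times> 'g) \<times> 'r"
  obtain p r where x: "x = (p, r)" by (cases x)
  have "unrot (rot k) x = (\<Sum>m\<in>UNIV. \<Sum>q\<in>UNIV. (V m p * V m q) *\<^sub>R k (q, r))"
    by (simp add: x rot_def unrot_def scaleR_sum_right)
  also have "\<dots> = (\<Sum>q\<in>UNIV. of_bool (p = q) *\<^sub>R k (q, r))"
    by (subst sum.swap) (simp add: scaleR_sum_left[symmetric] cols)
  also have "\<dots> = k x" by (simp add: x of_bool_def if_distrib[where f="\<lambda>c. c *\<^sub>R _"] cong: if_cong)
  finally show "unrot (rot k) x = k x" .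
qed

text \<open>
  In matrix unit coordinates the free product splits as \<open>\<complex>\<^sup>g \<otimes> H\<close>: the row index of the
  matrix unit is split off, and the column index stays with the node.  The functions \<open>ins j\<close> and \<open>prj j\<close> are
  the inclusion of, and the projection to, the \<open>j\<close>-th summand \<open>H\<close>.
\<close>

definition ins :: "'g \<Rightarrow> ('g \<times> 'r \<Rightarrow> 'v::real_vector) \<Rightarrow> ('g \<times> 'g) \<times> 'r \<Rightarrow> 'v"
  where "ins j h = (\<lambda>((i, a), r). if i = j then h (a, r) else 0)"

definition prj :: "'g \<Rightarrow> (('g \<times> 'g) \<times> 'r \<Rightarrow> 'v::real_vector) \<Rightarrow> 'g \<times> 'r \<Rightarrow> 'v"
  where "prj i k = (\<lambda>(a, r). k ((i, a), r))"

text \<open>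
  The operator of \<open>u\<^sup>e\<close> in matrix unit coordinates.  It is composition with the inverse shift, as
  functions are pulled back.
\<close>

definition step :: "int \<Rightarrow> (('g \<times> 'g) \<times> 'g node \<Rightarrow> 'v::real_vector) \<Rightarrow> ('g \<times> 'g) \<times> 'g node \<Rightarrow> 'v"
  where "step e k = rot (\<lambda>x. unrot k (shift (- e) x))"

definition entry_act :: "int \<Rightarrow> 'g \<Rightarrow> 'g \<Rightarrow> ('g \<times> 'g node \<Rightarrow> 'v::real_vector) \<Rightarrow> 'g \<times> 'g node \<Rightarrow> 'v"
  where "entry_act e i j h = prj i (step e (ins j h))"

lemma step_inverse: "e \<noteq> 0 \<Longrightarrow> step (- e) (step e k) = k"
  using shift_inverse[of e] by (simp add: step_def unrot_rot rot_unrot)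

lemma sum_of_bool_scaleR: "(\<Sum>q\<in>(UNIV::'q::finite set). of_bool (p = q) *\<^sub>R (f q :: 'v::real_vector)) = f p"
  by (simp add: of_bool_def if_distrib[where f="\<lambda>c. c *\<^sub>R _"] cong: if_cong)

lemma rot_sum: "rot (\<lambda>x. \<Sum>u\<in>S. f u x) = (\<lambda>x. \<Sum>u\<in>S. rot (f u) x)"
  and unrot_sum: "unrot (\<lambda>x. \<Sum>u\<in>S. f u x) = (\<lambda>x. \<Sum>u\<in>S. unrot (f u) x)"
  by (auto simp: rot_def unrot_def fun_eq_iff scaleR_sum_right intro: sum.swap)

lemma step_sum: "step e (\<lambda>x. \<Sum>u\<in>S. f u x) = (\<lambda>x. \<Sum>u\<in>S. step e (f u) x)"
  by (simp add: step_def rot_sum unrot_sum)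

lemma entry_act_linear:
  fixes c :: "'i \<Rightarrow> complex"
  shows "entry_act e i j (\<lambda>x. \<Sum>u\<in>S. c u * f u x) = (\<lambda>x. \<Sum>u\<in>S. c u * entry_act e i j (f u) x)"
proof -
  have ins: "ins j (\<lambda>x. \<Sum>u\<in>S. c u * f u x) = (\<lambda>x. \<Sum>u\<in>S. c u * ins j (f u) x)"
    by (auto simp: ins_def fun_eq_iff)
  have "step e (\<lambda>x. c * f x) = (\<lambda>x. c * step e f x)"
    for c and f :: "('g \<times> 'g) \<times> 'g node \<Rightarrow> complex"
  proof -
    have "rot (\<lambda>x. c * k x) = (\<lambda>x. c * rot k x)" "unrot (\<lambda>x. c * k x) = (\<lambda>x. c * unrot k x)"
      for k :: "('g \<times> 'g) \<times> 'g node \<Rightarrow> complex"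
      by (auto simp: rot_def unrot_def fun_eq_iff scaleR_sum_right sum_distrib_left)
    then show ?thesis by (simp add: step_def)
  qed
  then show ?thesis
    by (auto simp: entry_act_def step_sum ins prj_def fun_eq_iff)
qed

text \<open>
  The sum over \<open>k\<close> is the product of the block row \<open>i\<close> of \<open>u\<^sup>-\<^sup>e\<close> and the block column \<open>j\<close> of \<open>u\<^sup>e\<close>.
\<close>

lemma entry_act_unitary:
  assumes "e \<noteq> 0"
  shows "(\<Sum>k\<in>UNIV. entry_act (- e) i k (entry_act e k j h) x) = (if i = j then h x else (0::complex))"
proof -
  let ?K = "step e (ins j h)"
  have "(\<Sum>k\<in>UNIV. entry_act (- e) i k (entry_act e k j h) x)
      = (\<Sum>k\<in>UNIV. prj i (step (- e) (ins k (prj k ?K))) x)"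
    by (simp add: entry_act_def)
  also have "\<dots> = prj i (step (- e) (\<lambda>z. \<Sum>k\<in>UNIV. ins k (prj k ?K) z)) x"
    by (cases x) (simp add: prj_def step_sum)
  also have "(\<lambda>z. \<Sum>k\<in>UNIV. ins k (prj k ?K) z) = ?K"
    by (auto simp: ins_def prj_def fun_eq_iff)
  also have "prj i (step (- e) ?K) x = (if i = j then h x else 0)"
    by (cases x) (simp add: step_inverse[OF assms] prj_def ins_def)
  finally show ?thesis .
qed

fun letter_act :: "'g letter \<Rightarrow> ('g \<times> 'g node \<Rightarrow> 'v::real_vector) \<Rightarrow> 'g \<times> 'g node \<Rightarrow> 'v"
  where
    "letter_act (X i j) = entry_act 1 i j"
  | "letter_act (XT i j) = entry_act (- 1) j i"

definition word_act :: "'g letter free_monoid \<Rightarrow> ('g \<times> 'g node \<Rightarrow> complex) \<Rightarrow> 'g \<times> 'g node \<Rightarrow> complex"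
  where "word_act w h = foldr letter_act (letters w) h"

definition act :: "'g ncpoly \<Rightarrow> ('g \<times> 'g node \<Rightarrow> complex) \<Rightarrow> 'g \<times> 'g node \<Rightarrow> complex"
  where "act p h = (\<lambda>x. lin (\<lambda>w. word_act w h x) p)"

lemma letter_act_linear:
  fixes c :: "'i \<Rightarrow> complex"
  shows "letter_act l (\<lambda>x. \<Sum>u\<in>S. c u * f u x) = (\<lambda>x. \<Sum>u\<in>S. c u * letter_act l (f u) x)"
  by (cases l) (simp_all add: entry_act_linear)

lemma word_act_linear:
  "word_act w (\<lambda>x. \<Sum>u\<in>S. c u * f u x) = (\<lambda>x. \<Sum>u\<in>S. c u * word_act w (f u) x)"
proof -
  have "foldr letter_act ls (\<lambda>x. \<Sum>u\<in>S. c u * f u x) = (\<lambda>x. \<Sum>u\<in>S. c u * foldr letter_act ls (f u) x)" for ls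
    by (induction ls) (simp_all add: letter_act_linear)
  then show ?thesis by (simp add: word_act_def)
qed

lemma word_act_plus: "word_act (v + w) h = word_act v (word_act w h)"
  by (simp add: word_act_def plus_free_monoid_def)

lemma act_single: "act (Poly_Mapping.single w c) h = (\<lambda>x. c * word_act w h x)"
  by (simp add: act_def)

lemma act_add: "act (p + q) h = (\<lambda>x. act p h x + act q h x)"
  by (simp add: act_def lin_add)

lemma act_mult: "act (p * q) h = act p (act q h)"
proof (induction p rule: poly_mapping_additive_induct)
  case (single v a)
  have "act (Poly_Mapping.single v a * q) h = (\<lambda>x. a * (\<Sum>w\<in>Poly_Mapping.keys q. Poly_Mapping.lookup q w * word_act v (word_act w h) x))"
  proof (induction q rule: poly_mapping_additive_induct)
    case (single w b)
    then show ?case by (simp add: mult_single act_single word_act_plus mult.assoc)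
  next
    case (add p q)
    then show ?case
      by (simp add: distrib_left act_add fun_eq_iff lin_add[unfolded lin_def])
  qed
  then show ?case
    by (simp add: act_single) (simp add: act_def lin_def word_act_linear)
qed (simp add: distrib_right act_add)

lemma act_gen: "act (gen l) h = letter_act l h"
  by (simp add: gen_def act_single word_act_def)

lemma act_one: "act 1 h = h"
  unfolding single_one[symmetric] act_single by (simp add: word_act_def zero_free_monoid_def)

lemma act_zero: "act 0 h = (\<lambda>x. 0)"
  by (simp add: act_def)

lemma act_of_bool: "act (of_bool b) h = (\<lambda>x. of_bool b * h x)"
  by (simp add: act_one act_zero)

lemma act_diff: "act (p - q) h = (\<lambda>x. act p h x - act q h x)"
  by (simp add: act_def lin_diff)

lemma act_sum: "act (sum p S) h = (\<lambda>x. \<Sum>k\<in>S. act (p k) h x)"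
  by (simp add: act_def lin_sum)

text \<open>
  The polynomials that act as zero form a two-sided ideal, and it contains the relations by
  \<open>entry_act_unitary\<close>.
\<close>

lemma act_ideal:
  assumes "p \<in> unitary_ideal"
  shows "act p h = (\<lambda>x. 0)"
proof -
  have zero: "act p (\<lambda>x. 0) = (\<lambda>x. 0)" for p
  proof -
    have "word_act w (\<lambda>x. 0) = (\<lambda>x. 0)" for w
      using word_act_linear[of w _ _ "{}"] by simp
    then show ?thesis by (simp add: act_def lin_def)
  qed
  have "unitary_ideal \<subseteq> {p. \<forall>h. act p h = (\<lambda>x. 0)}"
  proof (rule unitary_ideal_minimal)
    show "two_sided_ideal {p. \<forall>h. act p h = (\<lambda>x. 0)}"
      by (auto simp: two_sided_ideal_def act_add act_mult act_zero zero)
    show "of_bool (i = j) - (\<Sum>k\<in>UNIV. gen (XT k i) * gen (X k j)) \<in> {p. \<forall>h. act p h = (\<lambda>x. 0)}"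
      for i j :: 'g
      using entry_act_unitary[of 1 i j]
      by (simp add: act_diff act_of_bool act_sum act_mult act_gen fun_eq_iff)
    show "of_bool (i = j) - (\<Sum>k\<in>UNIV. gen (X i k) * gen (XT j k)) \<in> {p. \<forall>h. act p h = (\<lambda>x. 0)}"
      for i j :: 'g
      using entry_act_unitary[of "-1" i j]
      by (simp add: act_diff act_of_bool act_sum act_mult act_gen fun_eq_iff)
  qed
  then show ?thesis using assms by blast
qed

section \<open>Faithfulness of the action\<close>

lemma supp_rot: "supp k \<subseteq> UNIV \<times> R \<Longrightarrow> supp (rot k) \<subseteq> UNIV \<times> R"
  by (auto simp: supp_def rot_def intro!: sum.neutral)

lemma supp_unrot: "supp k \<subseteq> UNIV \<times> R \<Longrightarrow> supp (unrot k) \<subseteq> UNIV \<times> R"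
  by (auto simp: supp_def unrot_def intro!: sum.neutral)

lemma finite_supp_cylinder:
  fixes k :: "'a::finite \<times> 'r \<Rightarrow> 'v::zero"
  assumes "finite (supp k)"
  obtains R where "finite R" "supp k \<subseteq> UNIV \<times> R"
  using assms by (intro that[of "snd ` supp k"]) (auto intro: rev_image_eqI)

lemma sum_cylinder: "(\<Sum>x\<in>A \<times> B. f x) = (\<Sum>a\<in>A. \<Sum>b\<in>B. f (a, b))"
  by (simp add: sum.cartesian_product)

text \<open>
  Since \<open>V\<close> is a real matrix acting on the labels alone, its transpose acts on the other side of the
  pairing.
\<close>

lemma pair_rot:
  assumes sc: "bilinear sc" and fin: "finite (supp k)"
  shows "pair sc \<phi> (rot k) = pair sc (unrot \<phi>) k" "finite (supp (rot k))"
    "pair sc \<phi> (unrot k) = pair sc (rot \<phi>) k" "finite (supp (unrot k))"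
proof -
  obtain R where R: "finite R" "supp k \<subseteq> UNIV \<times> R"
    using finite_supp_cylinder[OF fin] by blast
  have fR: "finite ((UNIV :: ('g \<times> 'g) set) \<times> R)" using R(1) by simp
  note sup = supp_rot[OF R(2)] supp_unrot[OF R(2)]
  show "finite (supp (rot k))" "finite (supp (unrot k))"
    using sup fR by (meson finite_subset)+
  have sc_sum: "sc (\<Sum>m\<in>UNIV. a m *\<^sub>R z m) v = (\<Sum>m\<in>UNIV. a m *\<^sub>R sc (z m) v)"
    "sc c (\<Sum>m\<in>UNIV. a m *\<^sub>R y m) = (\<Sum>m\<in>UNIV. a m *\<^sub>R sc c (y m))"
    for a :: "'g \<times> 'g \<Rightarrow> real" and z v c y
  proof -
    have l1: "linear (\<lambda>x. sc x v)" and l2: "linear (sc c)" using sc by (auto simp: bilinear_def)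
    show "sc (\<Sum>m\<in>UNIV. a m *\<^sub>R z m) v = (\<Sum>m\<in>UNIV. a m *\<^sub>R sc (z m) v)"
      by (simp add: linear_sum[OF l1] linear_cmul[OF l1])
    show "sc c (\<Sum>m\<in>UNIV. a m *\<^sub>R y m) = (\<Sum>m\<in>UNIV. a m *\<^sub>R sc c (y m))"
      by (simp add: linear_sum[OF l2] linear_cmul[OF l2])
  qed
  have "pair sc \<phi> (rot k) = (\<Sum>p\<in>UNIV. \<Sum>r\<in>R. \<Sum>m\<in>UNIV. V p m *\<^sub>R sc (k (m, r)) (\<phi> (p, r)))"
    unfolding pair_superset[OF sc fR sup(1)] sum_cylinder
    by (simp add: rot_def sc_sum)
  also have "\<dots> = (\<Sum>m\<in>UNIV. \<Sum>r\<in>R. \<Sum>p\<in>UNIV. V p m *\<^sub>R sc (k (m, r)) (\<phi> (p, r)))"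
    by (subst sum.swap, subst (2) sum.swap, subst (2) sum.swap) (rule refl)
  also have "\<dots> = pair sc (unrot \<phi>) k"
    unfolding pair_superset[OF sc fR R(2)] sum_cylinder
    by (simp add: unrot_def sc_sum)
  finally show "pair sc \<phi> (rot k) = pair sc (unrot \<phi>) k" .
  have "pair sc \<phi> (unrot k) = (\<Sum>m\<in>UNIV. \<Sum>r\<in>R. \<Sum>p\<in>UNIV. V p m *\<^sub>R sc (k (p, r)) (\<phi> (m, r)))"
    unfolding pair_superset[OF sc fR sup(2)] sum_cylinder
    by (simp add: unrot_def sc_sum)
  also have "\<dots> = (\<Sum>p\<in>UNIV. \<Sum>r\<in>R. \<Sum>m\<in>UNIV. V p m *\<^sub>R sc (k (p, r)) (\<phi> (m, r)))"
    by (subst sum.swap, subst (2) sum.swap, subst (2) sum.swap) (rule refl)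
  also have "\<dots> = pair sc (rot \<phi>) k"
    unfolding pair_superset[OF sc fR R(2)] sum_cylinder
    by (simp add: rot_def sc_sum)
  finally show "pair sc \<phi> (unrot k) = pair sc (rot \<phi>) k" .
qed

lemma pair_shift:
  assumes "e \<noteq> 0" "finite (supp k)"
  shows "pair sc \<phi> (\<lambda>x. k (shift (- e) x)) = pair sc (\<lambda>x. \<phi> (shift e x)) k"
    "finite (supp (\<lambda>x. k (shift (- e) x)))"
proof -
  have inv: "shift (- e) (shift e x) = x" "shift e (shift (- e) x) = x" for x
    using shift_inverse[of e] shift_inverse[of "- e"] assms(1) by auto
  have supp: "supp (\<lambda>x. k (shift (- e) x)) = shift e ` supp k"
  proof (intro set_eqI iffI)
    show "x \<in> shift e ` supp k" if "x \<in> supp (\<lambda>x. k (shift (- e) x))" for x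
      using that inv(2)[of x] by (intro image_eqI[of _ _ "shift (- e) x"]) (simp_all add: supp_def)
  qed (auto simp: supp_def inv)
  then show "finite (supp (\<lambda>x. k (shift (- e) x)))" using assms(2) by simp
  have "inj_on (shift e) (supp k)" by (rule inj_on_inverseI) (rule inv)
  then show "pair sc \<phi> (\<lambda>x. k (shift (- e) x)) = pair sc (\<lambda>x. \<phi> (shift e x)) k"
    unfolding pair_def supp by (simp add: sum.reindex inv)
qed

lemma pair_ins:
  assumes "finite (supp h)"
  shows "pair sc \<phi> (ins j h) = pair sc (prj j \<phi>) h" "finite (supp (ins j h))"
proof -
  have supp: "supp (ins j h) = (\<lambda>(a, r). ((j, a), r)) ` supp h"
    by (auto simp: supp_def ins_def image_iff split: if_splits)
  then show "finite (supp (ins j h))" using assms by simp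
  have "inj_on (\<lambda>(a, r). ((j, a), r)) (supp h)" by (auto simp: inj_on_def)
  then show "pair sc \<phi> (ins j h) = pair sc (prj j \<phi>) h"
    unfolding pair_def supp by (simp add: sum.reindex) (simp add: ins_def prj_def case_prod_beta)
qed

lemma pair_prj:
  assumes "bilinear sc" "finite (supp k)"
  shows "pair sc \<phi> (prj i k) = pair sc (ins i \<phi>) k" "finite (supp (prj i k))"
proof -
  let ?f = "\<lambda>(a, r). ((i, a), r)"
  have inj: "inj_on ?f A" for A by (auto simp: inj_on_def)
  have img: "?f ` supp (prj i k) \<subseteq> supp k" by (auto simp: supp_def prj_def)
  then show "finite (supp (prj i k))"
    using assms(2) inj finite_imageD finite_subset by metis
  have "pair sc \<phi> (prj i k) = (\<Sum>x\<in>?f ` supp (prj i k). sc (k x) (ins i \<phi> x))"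
    unfolding pair_def sum.reindex[OF inj] by (simp add: ins_def prj_def case_prod_beta)
  also have "\<dots> = pair sc (ins i \<phi>) k"
    unfolding pair_def using assms(2) img
    by (intro sum.mono_neutral_left)
      (auto simp: ins_def supp_def prj_def image_iff bilinear_rzero[OF assms(1)])
  finally show "pair sc \<phi> (prj i k) = pair sc (ins i \<phi>) k" .
qed

lemma pair_entry_act:
  assumes sc: "bilinear sc" and e: "e \<noteq> 0" and h: "finite (supp h)"
  shows "pair sc \<phi> (entry_act e i j h) = pair sc (entry_act (- e) j i \<phi>) h"
    "finite (supp (entry_act e i j h))"
  using h sc e
  by (simp_all add: entry_act_def step_def pair_rot pair_shift pair_ins pair_prj)

definition gen_entry :: "int \<Rightarrow> 'g \<Rightarrow> 'g \<Rightarrow> 'g ncpoly"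
  where "gen_entry e i k = (if e = 1 then gen (X i k) else gen (XT k i))"

text \<open>
  Multiplication of a column of polynomials by the matrix \<open>X\<close> (for \<open>e = 1\<close>) or by its adjoint
  (for \<open>e = -1\<close>).
\<close>

definition mulX :: "int \<Rightarrow> ('g \<Rightarrow> 'g ncpoly) \<Rightarrow> 'g \<Rightarrow> 'g ncpoly"
  where "mulX e v i = (\<Sum>k\<in>UNIV. gen_entry e i k * v k)"

definition cong :: "('g \<Rightarrow> 'g ncpoly) \<Rightarrow> ('g \<Rightarrow> 'g ncpoly) \<Rightarrow> bool"
  where "cong v w \<longleftrightarrow> (\<forall>i. v i - w i \<in> unitary_ideal)"

lemma cong_refl [simp]: "cong v v"
  by (simp add: cong_def)

lemma cong_sym: "cong v w \<Longrightarrow> cong w v"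
  unfolding cong_def using ideal_uminus by fastforce

lemma mulX_inverse:
  assumes "e \<in> {1, - 1}"
  shows "cong (mulX e (mulX (- e) v)) v"
  unfolding cong_def
proof
  fix i
  have "mulX e (mulX (- e) v) i = (\<Sum>j\<in>UNIV. (\<Sum>k\<in>UNIV. gen_entry e i k * gen_entry (- e) k j) * v j)"
    unfolding mulX_def sum_distrib_left sum_distrib_right mult.assoc
    by (subst sum.swap) (rule refl)
  moreover have "v i = (\<Sum>j\<in>UNIV. of_bool (i = j) * v j)"
    by (simp add: of_bool_def if_distrib[where f="\<lambda>c. c * _"] cong: if_cong)
  ultimately have "v i - mulX e (mulX (- e) v) i
      = (\<Sum>j\<in>UNIV. (of_bool (i = j) - (\<Sum>k\<in>UNIV. gen_entry e i k * gen_entry (- e) k j)) * v j)"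
    by (simp only: sum_subtractf[symmetric] left_diff_distrib)
  also have "\<dots> \<in> unitary_ideal"
  proof (intro ideal_sum ideal_rmult)
    show "of_bool (i = j) - (\<Sum>k\<in>UNIV. gen_entry e i k * gen_entry (- e) k j) \<in> unitary_ideal" for j
      using assms ideal_XT_X[of i j] ideal_X_XT[of i j] by (auto simp: gen_entry_def)
  qed
  finally show "mulX e (mulX (- e) v) i - v i \<in> unitary_ideal"
    using ideal_uminus by fastforce
qed

text \<open>
  Integer powers of \<open>X\<close> acting on columns.  The negative ones are powers of the adjoint, so the law of
  exponents holds only modulo the ideal when the signs differ (\<open>mpow_step\<close>).
\<close>

definition mpow :: "int \<Rightarrow> ('g \<Rightarrow> 'g ncpoly) \<Rightarrow> 'g \<Rightarrow> 'g ncpoly"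
  where "mpow n v = (if 0 \<le> n then (mulX 1 ^^ nat n) v else (mulX (- 1) ^^ nat (- n)) v)"

lemma mpow_zero [simp]: "mpow 0 v = v"
  by (simp add: mpow_def)

lemma mpow_step_away:
  assumes "e \<in> {1, - 1}" "0 \<le> e * n"
  shows "mpow (n + e) v = mulX e (mpow n v)"
proof (cases "e = 1")
  case True
  then show ?thesis using assms by (simp add: mpow_def nat_add_distrib)
next
  case False
  then have [simp]: "e = - 1" using assms by simp
  then have "n \<le> 0" using assms by simp
  then have "nat (- (n - 1)) = Suc (nat (- n))" by simp
  with \<open>n \<le> 0\<close> show ?thesis
    by (cases "n = 0") (simp_all add: mpow_def)
qed

lemma mpow_step:
  assumes e: "e \<in> {1, - 1}"
  shows "cong (mpow (n + e) v) (mulX e (mpow n v))"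
proof (cases "0 \<le> e * n")
  case True
  then show ?thesis by (simp add: mpow_step_away[OF e])
next
  case False
  then have "0 \<le> - e * (n + e)" using e by auto
  then have "mpow n v = mulX (- e) (mpow (n + e) v)"
    using mpow_step_away[of "- e" "n + e" v] e by auto
  then show ?thesis using mulX_inverse[OF e] cong_sym by simp
qed

text \<open>
  Multiplication of a column of polynomials by the scalar matrix \<open>b\<^sub>m\<close>.
\<close>

definition block_col :: "'g \<times> 'g \<Rightarrow> ('g \<Rightarrow> 'g ncpoly) \<Rightarrow> 'g \<Rightarrow> 'g ncpoly"
  where "block_col m y i = sqrt (of_nat CARD('g)) *\<^sub>R (\<Sum>j\<in>UNIV. V (i, j) m *\<^sub>R y j)"

lemma block_col_id: "block_col id_label y = y"
proof
  fix i
  have "(\<Sum>j\<in>UNIV. V (i, j) id_label *\<^sub>R y j) = (1 / sqrt (of_nat CARD('g))) *\<^sub>R (\<Sum>j\<in>UNIV. of_bool (i = j) *\<^sub>R y j)"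
    by (simp add: base_col scaleR_sum_right)
  then show "block_col id_label y i = y i"
    by (simp add: block_col_def sum_of_bool_scaleR)
qed

lemma block_col_zero: "block_col m (\<lambda>_. 0) = (\<lambda>_. 0)"
  by (simp add: block_col_def fun_eq_iff)

lemma mulX_zero: "mulX e (\<lambda>_. 0) = (\<lambda>_. 0)"
  by (simp add: mulX_def fun_eq_iff)

text \<open>
  A reduced word is read as a matrix over the free algebra, with \<open>X\<close> for \<open>u\<close>, of which only the
  column \<open>base\<close> is kept.
\<close>

fun node_col :: "'g node \<Rightarrow> 'g \<Rightarrow> 'g ncpoly"
  where
    "node_col [] = (\<lambda>i. of_bool (i = base))"
  | "node_col ((m, n) # r) =
      (if reduced ((m, n) # r) then mpow n (block_col m (node_col r)) else (\<lambda>_. 0))"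

definition point_col :: "('g \<times> 'g) \<times> 'g node \<Rightarrow> 'g \<Rightarrow> 'g ncpoly"
  where "point_col x = block_col (fst x) (node_col (snd x))"

lemma node_col_not_reduced: "\<not> reduced r \<Longrightarrow> node_col r = (\<lambda>_. 0)"
  by (cases r rule: node_col.cases) auto

text \<open>
  The map from reduced words to columns over the quotient turns left multiplication by \<open>u\<^sup>e\<close> into
  multiplication by \<open>X\<^sup>e\<close>.  This needs a proof only where a power of \<open>u\<close> is
  prolonged or shortened; where a new power starts, it holds by construction.
\<close>

lemma point_col_shift:
  assumes e: "e \<in> {1, - 1}"
  shows "cong (point_col (shift e x)) (mulX e (point_col x))"
proof -
  obtain m r where x: "x = (m, r)" by (cases x)
  have e0: "e \<noteq> 0" using e by auto
  consider (bad) "\<not> reduced r" | (start) "reduced r" "m \<noteq> id_label \<or> r = []"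
    | (line) m' n r' where "reduced r" "m = id_label" "r = (m', n) # r'"
    by (metis neq_Nil_conv surj_pair)
  then show ?thesis
  proof cases
    case bad
    then show ?thesis
      by (simp add: x shift.simps point_col_def node_col_not_reduced block_col_zero mulX_zero)
  next
    case start
    then have "shift e x = (id_label, (m, e) # r)" by (auto simp: x shift.simps)
    then have "point_col (shift e x) = mpow (0 + e) (point_col x)"
      using start e0 by (auto simp: x point_col_def block_col_id)
    then show ?thesis using mpow_step_away[OF e, of 0] by simp
  next
    case line
    let ?y = "block_col m' (node_col r')"
    have pt: "point_col x = mpow n ?y"
      using line by (simp add: x point_col_def block_col_id)
    have "point_col (shift e x) = mpow (n + e) ?y"
      using line e0 by (auto simp: x shift.simps point_col_def block_col_id)
    then show ?thesis using mpow_step[OF e] by (simp add: pt)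
  qed
qed

text \<open>
  The values of the map from \<open>H\<close> back to the free algebra on basis vectors.  A matrix unit with
  row index \<open>i\<close> and column index \<open>a\<close>, applied to a column, moves its entry \<open>a\<close> to position \<open>i\<close>; the row index
  has been split off, and the entry \<open>a\<close> remains.  The factor \<open>\<surd>g\<close> normalises the matrix units.
\<close>

definition to_alg :: "'g \<times> 'g node \<Rightarrow> 'g ncpoly"
  where "to_alg = (\<lambda>(a, r). sqrt (of_nat CARD('g)) *\<^sub>R node_col r a)"

lemma unrot_ins_to_alg: "unrot (ins i to_alg) x = point_col x i"
proof -
  obtain m r where x: "x = (m, r)" by (cases x)
  have "unrot (ins i to_alg) x = (\<Sum>c\<in>UNIV. \<Sum>a\<in>UNIV. if c = i then V (c, a) m *\<^sub>R to_alg (a, r) else 0)"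
    unfolding x unrot_def case_prod_conv sum.cartesian_product UNIV_Times_UNIV[symmetric]
    by (rule sum.cong) (auto simp: ins_def)
  also have "\<dots> = (\<Sum>a\<in>UNIV. V (i, a) m *\<^sub>R to_alg (a, r))"
    by (subst sum.swap) simp
  also have "\<dots> = point_col x i"
    by (simp add: x point_col_def block_col_def to_alg_def scaleR_sum_right mult.commute)
  finally show ?thesis .
qed

text \<open>
  In the coordinates of the basis \<open>b\<close> this is \<open>point_col_shift\<close>.  The orthogonal matrix has real, hence
  central, entries, so it commutes with multiplication by the generators and cancels against its
  transpose.
\<close>

lemma entry_act_to_alg:
  assumes e: "e \<in> {1, - 1}"
  shows "entry_act (- e) j i to_alg x - gen_entry e i j * to_alg x \<in> unitary_ideal"
proof -
  obtain a r where x: "x = (a, r)" by (cases x)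
  have lhs: "entry_act (- e) j i to_alg x = (\<Sum>m\<in>UNIV. V (j, a) m *\<^sub>R point_col (shift e (m, r)) i)"
    by (simp add: entry_act_def step_def prj_def x rot_def unrot_ins_to_alg)
  have "gen_entry e i j * to_alg x = (\<Sum>k\<in>UNIV. gen_entry e i k * rot (unrot (ins k to_alg)) ((j, a), r))"
    unfolding rot_unrot
    by (simp add: ins_def x if_distrib[where f="\<lambda>c. _ * c"] cong: if_cong)
  also have "\<dots> = (\<Sum>k\<in>UNIV. \<Sum>m\<in>UNIV. V (j, a) m *\<^sub>R (gen_entry e i k * point_col (m, r) k))"
    by (simp add: rot_def unrot_ins_to_alg sum_distrib_left scaleR_ncpoly cst_left_commute)
  also have "\<dots> = (\<Sum>m\<in>UNIV. V (j, a) m *\<^sub>R mulX e (point_col (m, r)) i)"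
    by (subst sum.swap) (simp add: mulX_def scaleR_sum_right)
  finally have "entry_act (- e) j i to_alg x - gen_entry e i j * to_alg x
      = (\<Sum>m\<in>UNIV. cst (of_real (V (j, a) m)) * (point_col (shift e (m, r)) i - mulX e (point_col (m, r)) i))"
    unfolding lhs by (simp add: sum_subtractf[symmetric] scaleR_ncpoly right_diff_distrib)
  also have "\<dots> \<in> unitary_ideal"
    using point_col_shift[OF e] by (intro ideal_sum ideal_lmult) (simp add: cong_def)
  finally show ?thesis .
qed

section \<open>The state of the empty word\<close>

definition cscale :: "complex \<Rightarrow> 'g ncpoly \<Rightarrow> 'g ncpoly"
  where "cscale c q = cst c * q"

lemma bilinear_cscale: "bilinear cscale"
proof -
  have "cscale (r *\<^sub>R c) q = r *\<^sub>R cscale c q" for r c q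
    by (simp add: cscale_def scaleR_ncpoly scaleR_conv_of_real[where 'a=complex] cst_simps(4) mult.assoc)
  moreover have "cscale c (r *\<^sub>R q) = r *\<^sub>R cscale c q" for r c q
    unfolding cscale_def scaleR_ncpoly by (rule cst_left_commute)
  ultimately show ?thesis
    by (simp add: bilinear_def linear_iff cscale_def distrib_left distrib_right cst_simps(3))
qed

lemma bilinear_mult_complex: "bilinear ((*) :: complex \<Rightarrow> complex \<Rightarrow> complex)"
  by (auto simp: bilinear_def linear_iff algebra_simps)

lemma finite_supp_add: "finite (supp h) \<Longrightarrow> finite (supp k) \<Longrightarrow> finite (supp (\<lambda>x. h x + k x :: complex))"
  by (rule finite_subset[of _ "supp h \<union> supp k"]) (auto simp: supp_def)

lemma finite_supp_cmult: "finite (supp h) \<Longrightarrow> finite (supp (\<lambda>x. c * h x :: complex))"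
  by (rule finite_subset[of _ "supp h"]) (auto simp: supp_def)

lemma finite_supp_letter_act: "finite (supp h) \<Longrightarrow> finite (supp (letter_act l h :: _ \<Rightarrow> complex))"
  by (cases l) (simp_all add: pair_entry_act(2)[OF bilinear_mult_complex])

lemma finite_supp_word_act: "finite (supp h) \<Longrightarrow> finite (supp (word_act w h))"
proof -
  assume "finite (supp h)"
  then have "finite (supp (foldr letter_act ls h))" for ls
    by (induction ls) (simp_all add: finite_supp_letter_act)
  then show ?thesis by (simp add: word_act_def)
qed

lemma finite_supp_act: "finite (supp h) \<Longrightarrow> finite (supp (act p h))"
  by (induction p rule: poly_mapping_additive_induct)
    (simp_all add: act_single act_add finite_supp_word_act finite_supp_cmult finite_supp_add)

lemma pair_add:
  assumes "bilinear sc" "finite (supp h)" "finite (supp k)"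
  shows "pair sc \<phi> (\<lambda>x. h x + k x) = pair sc \<phi> h + pair sc \<phi> k"
proof -
  let ?S = "supp h \<union> supp k"
  have S: "finite ?S" "supp (\<lambda>x. h x + k x) \<subseteq> ?S" "supp h \<subseteq> ?S" "supp k \<subseteq> ?S"
    using assms(2,3) by (auto simp: supp_def)
  show ?thesis
    by (simp add: pair_superset[OF assms(1) S(1)] S bilinear_ladd[OF assms(1)] sum.distrib)
qed

lemma pair_cscale_cmult: "pair cscale \<phi> (\<lambda>x. c * h x) = cst c * pair cscale \<phi> h"
proof (cases "c = 0")
  case False
  then have "supp (\<lambda>x. c * h x) = supp h" by (simp add: supp_def)
  then show ?thesis by (simp add: pair_def cscale_def cst_simps mult.assoc sum_distrib_left)
qed (simp add: pair_def supp_def cst_simps)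

lemma to_alg_letter_act:
  assumes h: "finite (supp h)"
  shows "pair cscale to_alg (letter_act l h) - gen l * pair cscale to_alg h \<in> unitary_ideal"
proof -
  have entry: "pair cscale to_alg (entry_act e i j h) - gen_entry e i j * pair cscale to_alg h \<in> unitary_ideal"
    if e: "e \<in> {1, - 1}" for e i j
  proof -
    have "e \<noteq> 0" using e by auto
    then have "pair cscale to_alg (entry_act e i j h) = pair cscale (entry_act (- e) j i to_alg) h"
      by (rule pair_entry_act(1)[OF bilinear_cscale _ h])
    then have "pair cscale to_alg (entry_act e i j h) - gen_entry e i j * pair cscale to_alg h
      = (\<Sum>x\<in>supp h. cst (h x) * (entry_act (- e) j i to_alg x - gen_entry e i j * to_alg x))"
      by (simp add: pair_def cscale_def sum_distrib_left cst_left_commute right_diff_distrib sum_subtractf)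
    also have "\<dots> \<in> unitary_ideal"
      by (intro ideal_sum ideal_lmult entry_act_to_alg e)
    finally show ?thesis .
  qed
  show ?thesis
  proof (cases l)
    case (X i j)
    then show ?thesis using entry[of 1 i j] by (simp add: gen_entry_def)
  next
    case (XT i j)
    then show ?thesis using entry[of "- 1" j i] by (simp add: gen_entry_def)
  qed
qed

text \<open>
  The map back to the algebra is a homomorphism of left modules, up to the ideal.
\<close>

lemma to_alg_act:
  assumes h: "finite (supp h)"
  shows "pair cscale to_alg (act p h) - p * pair cscale to_alg h \<in> unitary_ideal"
proof (induction p rule: poly_mapping_additive_induct)
  case (single w c)
  have list: "pair cscale to_alg (foldr letter_act ls h) - Poly_Mapping.single (Word ls) 1 * pair cscale to_alg h
      \<in> unitary_ideal" for ls
  proof (induction ls)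
    case Nil
    show ?case by (simp add: zero_free_monoid_def[symmetric])
  next
    case (Cons l ls)
    let ?h = "foldr letter_act ls h"
    have "finite (supp ?h)" using finite_supp_word_act[OF h, of "Word ls"] by (simp add: word_act_def)
    note to_alg_letter_act[OF this, of l]
    moreover have "Poly_Mapping.single (Word (l # ls)) 1 = gen l * Poly_Mapping.single (Word ls) (1::complex)"
      by (simp add: gen_def mult_single plus_free_monoid_def)
    then have "gen l * pair cscale to_alg ?h - Poly_Mapping.single (Word (l # ls)) 1 * pair cscale to_alg h \<in> unitary_ideal"
      using ideal_lmult[OF Cons, of "gen l"] by (simp add: right_diff_distrib mult.assoc)
    ultimately show ?case by (simp add: ideal_diff_trans)
  qed
  have "Poly_Mapping.single w c * q = cst c * (Poly_Mapping.single w 1 * q)" for q :: "'g ncpoly"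
    by (simp add: cst_mult_single mult.assoc[symmetric])
  then show ?case
    using ideal_lmult[OF list[of "letters w"], of "cst c"]
    by (simp add: act_single pair_cscale_cmult word_act_def right_diff_distrib)
next
  case (add p q)
  then show ?case
    using ideal_add[OF add]
    by (simp add: act_add pair_add[OF bilinear_cscale] finite_supp_act[OF h] algebra_simps)
qed

text \<open>
  A component of the empty word: only one column of the identity matrix is needed, because its
  image in the algebra is already a nonzero scalar.
\<close>

definition root :: "'g \<times> 'g node \<Rightarrow> complex"
  where "root x = of_bool (x = (base, []))"

lemma supp_root: "supp root = {(base, [])}"
  by (auto simp: supp_def root_def)

text \<open>
  The map back to the algebra sends the vector \<open>act p root\<close> to \<open>p\<close> times the image of \<open>root\<close> modulo the
  ideal, and that image is the scalar \<open>\<surd>g\<close>.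
\<close>

lemma act_root_faithful:
  assumes "act p root = (\<lambda>x. 0)"
  shows "p \<in> unitary_ideal"
proof -
  let ?s = "complex_of_real (sqrt (of_nat CARD('g)))"
  have "pair cscale to_alg root = cst ?s"
    by (simp add: pair_def supp_root cscale_def root_def to_alg_def scaleR_ncpoly cst_simps)
  then have "p * cst ?s \<in> unitary_ideal"
    using to_alg_act[of root p] assms ideal_uminus by (fastforce simp: supp_root pair_def supp_def)
  then have "cst (1 / ?s) * (p * cst ?s) \<in> unitary_ideal" by (rule ideal_lmult)
  moreover have "cst (1 / ?s) * (p * cst ?s) = p"
  proof -
    have "(cst (1 / ?s) * cst ?s :: 'g ncpoly) = cst (1 / ?s * ?s)" by (rule cst_simps(4)[symmetric])
    also have "\<dots> = 1" by (simp add: cst_simps(2))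
    finally show ?thesis unfolding cst_central[of p] mult.assoc[symmetric] by simp
  qed
  ultimately show ?thesis by simp
qed

definition ip :: "('a \<Rightarrow> complex) \<Rightarrow> ('a \<Rightarrow> complex) \<Rightarrow> complex"
  where "ip h k = pair (*) (\<lambda>x. cnj (k x)) h"

lemma entry_act_cnj: "entry_act e i j (\<lambda>x. cnj (k x)) = (\<lambda>x. cnj (entry_act e i j k x))"
proof -
  have "ins j (\<lambda>x. cnj (k x)) = (\<lambda>x. cnj (ins j k x))"
    by (auto simp: ins_def)
  moreover have "rot (\<lambda>x. cnj (k x)) = (\<lambda>x. cnj (rot k x))" "unrot (\<lambda>x. cnj (k x)) = (\<lambda>x. cnj (unrot k x))"
    for k :: "('g \<times> 'g) \<times> 'g node \<Rightarrow> complex"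
    by (auto simp: rot_def unrot_def fun_eq_iff)
  ultimately show ?thesis
    by (auto simp: entry_act_def step_def prj_def)
qed

lemma ip_letter_act:
  "finite (supp h) \<Longrightarrow> ip (letter_act l h) k = ip h (letter_act (star_letter l) k)"
  by (cases l) (simp_all add: ip_def pair_entry_act(1)[OF bilinear_mult_complex] entry_act_cnj)

lemma ip_word_act:
  assumes "finite (supp h)"
  shows "ip (word_act w h) k = ip h (word_act (star_word w) k)"
proof -
  have "ip (foldr letter_act ls h) k = ip h (foldr letter_act (rev (map star_letter ls)) k)" for ls
  proof (induction ls arbitrary: k)
    case (Cons l ls)
    have "finite (supp (foldr letter_act ls h))"
      using finite_supp_word_act[OF assms, of "Word ls"] by (simp add: word_act_def)
    then show ?case by (simp add: ip_letter_act Cons)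
  qed simp
  then show ?thesis by (simp add: word_act_def star_word_def)
qed

lemma ip_act:
  assumes h: "finite (supp h)"
  shows "ip (act p h) k = ip h (act (ncstar p) k)"
proof (induction p rule: poly_mapping_additive_induct)
  case (single w c)
  have "ip (\<lambda>x. c * h x) k = c * ip h k" "ip h (\<lambda>x. cnj c * k x) = c * ip h k" for h k :: "'g \<times> 'g node \<Rightarrow> complex"
  proof -
    show "ip (\<lambda>x. c * h x) k = c * ip h k"
      by (cases "c = 0") (simp_all add: ip_def pair_def supp_def sum_distrib_left mult.assoc)
    show "ip h (\<lambda>x. cnj c * k x) = c * ip h k"
      by (simp add: ip_def pair_def sum_distrib_left mult.left_commute)
  qed
  then show ?case by (simp add: act_single ncstar_single ip_word_act[OF h])
next
  case (add p q)
  have "ip h (\<lambda>x. k x + k' x) = ip h k + ip h k'" for h k k' :: "'g \<times> 'g node \<Rightarrow> complex"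
    by (simp add: ip_def pair_def sum.distrib distrib_left)
  then show ?case using add
    by (simp add: act_add ncstar_add ip_def pair_add[OF bilinear_mult_complex] finite_supp_act[OF h])
qed

lemma ip_cnj:
  assumes "finite (supp h)" "finite (supp k)"
  shows "ip k h = cnj (ip h k)"
proof -
  have S: "finite (supp h \<union> supp k)" using assms by simp
  show ?thesis unfolding ip_def
    by (simp add: pair_superset[OF bilinear_mult_complex S] mult.commute)
qed

lemma ip_pos:
  assumes "finite (supp h)" "h \<noteq> (\<lambda>x. 0)"
  shows "0 < Re (ip h h)"
proof -
  have "Re (ip h h) = (\<Sum>x\<in>supp h. (cmod (h x))\<^sup>2)"
    by (simp add: ip_def pair_def complex_norm_square[symmetric])
  also have "\<dots> > 0" using assms by (intro sum_pos) (auto simp: supp_def fun_eq_iff)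
  finally show ?thesis .
qed

text \<open>
  Strict positivity is faithfulness: the value at \<open>p\<^sup>* p\<close> is the square norm of \<open>act p root\<close>.
\<close>

lemma strict_state_root: "strict_state d (\<lambda>p. ip (act p root) root)"
proof -
  have root: "finite (supp root)" by (simp add: supp_root)
  have eval: "ip h root = h (base, [])" if "finite (supp h)" for h
  proof -
    have "ip h root = cnj (ip root h)" using ip_cnj[OF root that] ip_cnj[OF that root] by simp
    then show ?thesis by (simp add: ip_def pair_def supp_root root_def)
  qed
  have val: "ip (act p root) root = act p root (base, [])" for p
    by (rule eval) (rule finite_supp_act[OF root])
  have cst_act: "act (cst c * p) h = (\<lambda>x. c * act p h x)" for c p h
    by (simp add: act_def lin_cst_mult)
  show ?thesis
    unfolding strict_state_def
  proof (intro conjI allI ballI)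
    show "ip (act (ncstar p) root) root = cnj (ip (act p root) root)" for p
      using ip_act[OF root, of p root] ip_cnj[OF root finite_supp_act[OF root], of "ncstar p"] by simp
    show "0 < Re (ip (act (ncstar p * p) root) root)" if "p \<in> polys_upto d - unitary_ideal" for p
    proof -
      have "ip (act (ncstar p * p) root) root = ip (act p root) (act p root)"
        using ip_act[OF finite_supp_act[OF root, of p], of "ncstar p" root] by (simp add: act_mult)
      then show ?thesis using that act_root_faithful ip_pos[OF finite_supp_act[OF root]] by fastforce
    qed
  qed (simp_all only: val, simp_all add: act_add cst_act act_ideal)
qed

end

text \<open>
  A column of \<open>V\<close> may be prescribed to be any unit vector, because the orthogonal group acts
  transitively on the sphere; \<open>b\<close> is the identity matrix, normalised and read as a vector.
\<close>

lemma ex_rotation: "\<exists>V. rotation (undefined :: 'g::finite) V"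
proof -
  let ?u = "(undefined, undefined) :: 'g \<times> 'g"
  define b :: "real ^ ('g \<times> 'g)" where "b = (\<chi> p. of_bool (fst p = snd p) / sqrt (of_nat CARD('g)))"
  have "b \<bullet> b = (\<Sum>i\<in>(UNIV :: 'g set). \<Sum>j\<in>(UNIV :: 'g set). if i = j then 1 / of_nat CARD('g) else 0)"
    unfolding inner_vec_def UNIV_Times_UNIV[symmetric] sum.cartesian_product
    by (rule sum.cong) (auto simp: b_def)
  also have "\<dots> = 1" by simp
  finally have "norm b = norm (axis ?u (1::real))" by (simp add: norm_eq_sqrt_inner)
  then obtain f :: "real ^ ('g \<times> 'g) \<Rightarrow> real ^ ('g \<times> 'g)"
    where f: "orthogonal_transformation f" "f (axis ?u 1) = b"
    using orthogonal_transformation_exists[of "axis ?u (1::real)" b] by metis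
  let ?M = "matrix f"
  have M: "transpose ?M ** ?M = mat 1" "?M ** transpose ?M = mat 1"
    using f(1) orthogonal_transformation_matrix unfolding orthogonal_matrix_def by blast+
  have col: "?M $ p $ ?u = b $ p" for p
    using f(2) by (simp add: matrix_def)
  have "rotation undefined (\<lambda>p m. ?M $ p $ m)"
  proof
    show "(\<Sum>m\<in>UNIV. ?M $ p $ m * ?M $ q $ m) = of_bool (p = q)" for p q
      using arg_cong[OF M(2), of "\<lambda>A. A $ p $ q"] by (simp add: matrix_matrix_mult_def transpose_def mat_def)
    show "(\<Sum>p\<in>UNIV. ?M $ p $ m * ?M $ p $ n) = of_bool (m = n)" for m n
      using arg_cong[OF M(1), of "\<lambda>A. A $ m $ n"] by (simp add: matrix_matrix_mult_def transpose_def mat_def)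
    show "?M $ (i, j) $ ?u = of_bool (i = j) / sqrt (of_nat CARD('g))" for i j
      by (simp add: col b_def)
  qed
  then show ?thesis by blast
qed

lemma ex_strict_state: "\<exists>l :: 'g::finite ncpoly \<Rightarrow> complex. strict_state d l"
proof -
  obtain V where "rotation (undefined :: 'g) V" using ex_rotation by blast
  then show ?thesis using rotation.strict_state_root by blast
qed

section \<open>Unitary matrices with prescribed values\<close>

definition cip :: "complex ^ 'm \<Rightarrow> complex ^ 'm \<Rightarrow> complex"
  where "cip x y = (\<Sum>k\<in>UNIV. x $ k * cnj (y $ k))"

lemma cip_simps:
  fixes x y z :: "complex ^ 'm::finite"
  shows "cip (x + y) z = cip x z + cip y z" "cip (x - y) z = cip x z - cip y z" "cip (c *s x) z = c * cip x z"
    "cip z (x + y) = cip z x + cip z y" "cip z (x - y) = cip z x - cip z y" "cip z (c *s x) = cnj c * cip z x"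
    "cip 0 z = 0" "cip z 0 = 0"
  by (simp_all add: cip_def algebra_simps sum.distrib sum_subtractf sum_distrib_left)

lemma cip_cnj: "cnj (cip x y) = cip y (x :: complex ^ 'm::finite)"
  by (simp add: cip_def mult.commute)

lemma cip_self: "cip x x = of_real (\<Sum>k\<in>UNIV. (cmod (x $ k))\<^sup>2)" for x :: "complex ^ 'm::finite"
  by (simp add: cip_def complex_norm_square[symmetric])

lemma cip_self_eq_0: "cip x x = 0 \<longleftrightarrow> x = 0" for x :: "complex ^ 'm::finite"
proof -
  have "cip x x = 0 \<longleftrightarrow> (\<forall>k. x $ k = 0)"
    unfolding cip_self of_real_eq_0_iff by (subst sum_nonneg_eq_0_iff) auto
  then show ?thesis by (simp add: vec_eq_iff)
qed

definition isometry :: "complex ^ 'm::finite ^ 'm \<Rightarrow> bool"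
  where "isometry U \<longleftrightarrow> (\<forall>v w. cip (U *v v) (U *v w) = cip v w)"

text \<open>
  A complex version of the Householder reflection.  With \<open>z = x - y\<close> and \<open>a = \<langle>x, z\<rangle>\<close>, the matrix is
  \<open>1 - z z\<^sup>* / a\<close>.  It sends \<open>x\<close> to \<open>x - z = y\<close>.  It is unitary if and only if twice the real part of \<open>a\<close>
  is \<open>\<langle>z, z\<rangle>\<close>, and this follows from \<open>\<langle>x, x\<rangle> = \<langle>y, y\<rangle>\<close>.
\<close>

lemma complex_reflection:
  fixes x y :: "complex ^ 'm::finite"
  assumes eq: "cip x x = cip y y"
  obtains R where "isometry R" "R *v x = y" "\<And>v. cip v (x - y) = 0 \<Longrightarrow> R *v v = v"
proof (cases "x = y")
  case True
  then show ?thesis by (intro that[of "mat 1"]) (auto simp: isometry_def)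
next
  case False
  define z where "z = x - y"
  define a where "a = cip x z"
  \<comment> \<open>the condition for the matrix to be unitary\<close>
  have a: "a + cnj a = cip z z"
    by (simp add: a_def z_def cip_simps cip_cnj eq)
  have "cip z z \<noteq> 0" using False by (simp add: cip_self_eq_0 z_def)
  with a have a0: "a \<noteq> 0" by auto
  define R :: "complex ^ 'm ^ 'm" where "R = (\<chi> i j. (if i = j then 1 else 0) - z $ i * cnj (z $ j) / a)"
  have R: "R *v v = v - (cip v z / a) *s z" for v
  proof (subst vec_eq_iff, rule allI)
    fix i
    have "(R *v v) $ i = (\<Sum>j\<in>UNIV. (if i = j then v $ j else 0) - (z $ i / a) * (v $ j * cnj (z $ j)))"
      unfolding R_def matrix_vector_mult_def vec_lambda_beta
      by (rule sum.cong) (auto simp: algebra_simps)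
    then show "(R *v v) $ i = (v - (cip v z / a) *s z) $ i"
      by (simp only: sum_subtractf sum_distrib_left[symmetric] cip_def[symmetric]) (simp add: mult.commute)
  qed
  have "isometry R"
    unfolding isometry_def
  proof (intro allI)
    fix v w
    let ?p = "cip v z" and ?q = "cip z w"
    have q: "cip w z = cnj ?q" by (simp add: cip_cnj)
    have "cip (R *v v) (R *v w) = cip v w - ?p * ?q / cnj a - ?p / a * (?q - ?q / cnj a * cip z z)"
      by (simp add: R cip_simps q algebra_simps)
    also have "\<dots> = cip v w"
      using a0 by (simp add: a[symmetric] field_simps)
    finally show "cip (R *v v) (R *v w) = cip v w" .
  qed
  moreover have "R *v x = y" using a0 by (simp add: R a_def[symmetric]) (simp add: z_def)
  moreover have "R *v v = v" if "cip v (x - y) = 0" for v using that by (simp add: R z_def)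
  ultimately show ?thesis by (rule that)
qed

text \<open>
  The vectors are treated one at a time: once \<open>U\<close> is right on \<open>F\<close>, a reflection corrects its value
  at the new vector.  The reflection does not disturb the earlier values, because
  equality of the inner products makes the mirror vector orthogonal to all of them.
\<close>

lemma unitary_extension:
  fixes x y :: "'i \<Rightarrow> complex ^ 'm::finite"
  assumes "finite F" "\<And>i j. i \<in> F \<Longrightarrow> j \<in> F \<Longrightarrow> cip (x i) (x j) = cip (y i) (y j)"
  shows "\<exists>U. isometry U \<and> (\<forall>i\<in>F. U *v x i = y i)"
  using assms
proof (induction F)
  case empty
  show ?case by (rule exI[of _ "mat 1"]) (simp add: isometry_def)
next
  case (insert k F)
  then obtain U where U: "isometry U" "\<And>i. i \<in> F \<Longrightarrow> U *v x i = y i" by auto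
  have "cip (U *v x k) (U *v x k) = cip (y k) (y k)"
    using U(1) insert.prems by (simp add: isometry_def)
  then obtain R where R: "isometry R" "R *v (U *v x k) = y k"
      "\<And>v. cip v (U *v x k - y k) = 0 \<Longrightarrow> R *v v = v"
    by (rule complex_reflection) blast
  have "R *v y i = y i" if "i \<in> F" for i
  proof (rule R(3))
    have "cip (y i) (U *v x k) = cip (U *v x i) (U *v x k)" using U(2) that by simp
    also have "\<dots> = cip (x i) (x k)" using U(1) by (simp add: isometry_def)
    also have "\<dots> = cip (y i) (y k)" using insert.prems that by simp
    finally show "cip (y i) (U *v x k - y k) = 0" by (simp add: cip_simps)
  qed
  then have "\<forall>i\<in>insert k F. (R ** U) *v x i = y i"
    using U(2) R(2) by (auto simp: matrix_vector_mul_assoc[symmetric])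
  moreover have "isometry (R ** U)"
    using R(1) U(1) by (simp add: isometry_def matrix_vector_mul_assoc[symmetric])
  ultimately show ?case by blast
qed

lemma isometry_unitary:
  assumes "isometry U"
  shows "conj_transpose U ** U = mat 1"
proof -
  have "(conj_transpose U ** U) $ i $ j = (mat 1 :: complex ^ 'a ^ 'a) $ i $ j" for i j
  proof -
    have col: "(U *v axis k 1) $ m = U $ m $ k" for k m
      by (simp add: matrix_vector_mult_def axis_def if_distrib[where f="\<lambda>c. _ * c"] cong: if_cong)
    have "(conj_transpose U ** U) $ i $ j = cip (U *v axis j 1) (U *v axis i 1)"
      by (simp add: matrix_matrix_mult_def conj_transpose_def map_matrix_def transpose_def cip_def
          col mult.commute)
    also have "\<dots> = cip (axis j 1) (axis i 1)" using assms by (simp add: isometry_def)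
    also have "\<dots> = mat 1 $ i $ j"
      by (simp add: cip_def axis_def mat_def if_distrib[where f="\<lambda>c. c * _"] cong: if_cong)
    finally show ?thesis .
  qed
  then show ?thesis by (simp add: vec_eq_iff)
qed

section \<open>Orthonormal bases\<close>

definition expand :: "('g::finite ncpoly \<Rightarrow> complex) \<Rightarrow> 'g ncpoly set \<Rightarrow> 'g ncpoly \<Rightarrow> 'g ncpoly"
  where "expand l B p = (\<Sum>b\<in>B. cst (l (ncstar b * p)) * b)"

text \<open>
  Gram-Schmidt orthogonalisation for the form \<open>(p, q) \<mapsto> l(q\<^sup>* p)\<close>.  A remainder in the
  ideal is dropped; any other remainder has a positive square norm and can be normalised.
\<close>

lemma gram_schmidt:
  assumes l: "strict_state d l" and "finite F" "F \<subseteq> polys_upto d"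
  shows "\<exists>B. finite B \<and> card B \<le> card F \<and> B \<subseteq> polys_upto d
    \<and> (\<forall>b\<in>B. \<forall>c\<in>B. l (ncstar b * c) = of_bool (b = c)) \<and> (\<forall>p\<in>F. p - expand l B p \<in> unitary_ideal)"
  using assms(2,3)
proof (induction F)
  case empty
  show ?case by (rule exI[of _ "{}"]) simp
next
  case (insert p F)
  then obtain B where B: "finite B" "card B \<le> card F" "B \<subseteq> polys_upto d"
      and on: "\<And>b c. b \<in> B \<Longrightarrow> c \<in> B \<Longrightarrow> l (ncstar b * c) = of_bool (b = c)"
      and F: "\<And>q. q \<in> F \<Longrightarrow> q - expand l B q \<in> unitary_ideal"
    by auto
  have p: "p \<in> polys_upto d" and Fd: "F \<subseteq> polys_upto d" using insert.prems by auto
  have expand_deg: "expand l B q \<in> polys_upto d" for q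
    unfolding expand_def using B(3) by (auto intro!: polys_upto_sum polys_upto_cst_mult)
  have l_expand: "l (r * expand l B q) = (\<Sum>b\<in>B. l (ncstar b * q) * l (r * b))" for r q
    unfolding expand_def sum_distrib_left strict_state_sum[OF l] cst_left_commute strict_stateD(2)[OF l] ..
  define r where "r = p - expand l B p"
  have rd: "r \<in> polys_upto d" unfolding r_def by (intro polys_upto_diff p expand_deg)
  show ?case
  proof (cases "r \<in> unitary_ideal")
    case True
    show ?thesis
      using B on F True insert.hyps by (intro exI[of _ B]) (auto simp: r_def)
  next
    case False
    define \<nu> where "\<nu> = Re (l (ncstar r * r))"
    have \<nu>: "\<nu> > 0" unfolding \<nu>_def by (rule strict_stateD(5)[OF l rd False])
    have l_r: "l (ncstar r * r) = of_real \<nu>"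
      using strict_state_cnj[OF l, of r r] by (simp add: \<nu>_def complex_eq_iff)
    define s where "s = complex_of_real (sqrt \<nu>)"
    have s: "s \<noteq> 0" "s * s = of_real \<nu>" "cnj s = s"
      using \<nu> by (simp_all add: s_def of_real_mult[symmetric] del: of_real_mult)
    define e where "e = cst (1 / s) * r"
    have ed: "e \<in> polys_upto d" unfolding e_def by (rule polys_upto_cst_mult[OF rd])
    have orth_r: "l (ncstar b * r) = 0" if "b \<in> B" for b
    proof -
      have "(\<Sum>c\<in>B. l (ncstar c * p) * l (ncstar b * c)) = (\<Sum>c\<in>B. if b = c then l (ncstar c * p) else 0)"
        using on that by (intro sum.cong) auto
      then show ?thesis
        using that B(1) by (simp add: r_def right_diff_distrib strict_state_diff[OF l] l_expand)
    qed
    have orth: "l (ncstar b * e) = 0" "l (ncstar e * b) = 0" if "b \<in> B" for b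
    proof -
      show 1: "l (ncstar b * e) = 0"
        by (simp add: e_def cst_left_commute strict_stateD(2)[OF l] orth_r[OF that])
      show "l (ncstar e * b) = 0" using strict_state_cnj[OF l, of e b] 1 by simp
    qed
    have e_r: "l (ncstar e * r) = s"
      using s by (simp add: e_def ncstar_cst_mult mult.assoc strict_stateD(2)[OF l] l_r field_simps)
    have "ncstar e * e = cst (1 / s) * (ncstar e * r)"
      by (subst (2) e_def) (rule cst_left_commute)
    then have e_e: "l (ncstar e * e) = 1"
      using s(1) by (simp add: strict_stateD(2)[OF l] e_r)
    have "e \<notin> B" using orth(1) e_e by force
    then have expand': "expand l (insert e B) q = cst (l (ncstar e * q)) * e + expand l B q" for q
      using B(1) by (simp add: expand_def)
    have "q - expand l (insert e B) q \<in> unitary_ideal" if "q \<in> F" for q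
    proof -
      have "l (ncstar e * q) = l (ncstar e * expand l B q)"
        using that Fd by (intro strict_state_ideal_right[OF l] F expand_deg ed) auto
      also have "\<dots> = 0" unfolding l_expand using orth by simp
      finally show ?thesis using F[OF that] by (simp add: expand' cst_simps)
    qed
    moreover have "p - expand l (insert e B) p = 0"
    proof -
      have "l (ncstar e * p) = l (ncstar e * r) + l (ncstar e * expand l B p)"
        unfolding strict_stateD(1)[OF l, symmetric] distrib_left[symmetric] r_def by simp
      also have "\<dots> = s" unfolding l_expand e_r using orth by simp
      finally have "cst (l (ncstar e * p)) * e = cst (s * (1 / s)) * r"
        by (simp only: e_def mult.assoc[symmetric] cst_simps(4))
      also have "\<dots> = r" using s(1) by (simp add: cst_simps)
      finally show ?thesis unfolding expand' by (simp add: r_def)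
    qed
    moreover have "card (insert e B) \<le> card (insert p F)"
      using B insert.hyps \<open>e \<notin> B\<close> by simp
    ultimately show ?thesis
      using B ed on orth e_e \<open>e \<notin> B\<close> by (intro exI[of _ "insert e B"]) auto
  qed
qed

lemma sum_power_le: "(\<Sum>i\<le>d. q ^ i) \<le> (q + 1) ^ d" for q :: nat
proof (induction d)
  case (Suc d)
  have "q ^ Suc d \<le> q * (q + 1) ^ d"
    unfolding power_Suc by (intro mult_left_mono power_mono) simp_all
  with Suc have "(\<Sum>i\<le>d. q ^ i) + q ^ Suc d \<le> (q + 1) ^ d + q * (q + 1) ^ d"
    by (rule add_mono)
  then show ?case by simp
qed simp

lemma
  shows finite_short_words: "finite {w :: 'g::finite letter free_monoid. length (letters w) \<le> d}"
    and card_short_words: "card {w :: 'g letter free_monoid. length (letters w) \<le> d} \<le> (2 * CARD('g)\<^sup>2 + 1) ^ d"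
proof -
  have UNIV: "(UNIV :: 'g letter set) = (\<lambda>(i, j). X i j) ` UNIV \<union> (\<lambda>(i, j). XT i j) ` UNIV"
    by (auto simp: image_iff) (metis letter.exhaust)
  have fin: "finite (UNIV :: 'g letter set)"
    unfolding UNIV by (intro finite_UnI finite_imageI finite)
  have "card (UNIV :: 'g letter set) \<le> CARD('g \<times> 'g) + CARD('g \<times> 'g)"
    unfolding UNIV by (rule order_trans[OF card_Un_le] add_mono card_image_le finite)+
  then have q: "card (UNIV :: 'g letter set) \<le> 2 * CARD('g)\<^sup>2"
    by (simp add: power2_eq_square)
  have words: "{w :: 'g letter free_monoid. length (letters w) \<le> d} = Word ` {ls. set ls \<subseteq> UNIV \<and> length ls \<le> d}"
    by (auto simp: image_iff) (metis free_monoid.collapse)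
  show "finite {w :: 'g letter free_monoid. length (letters w) \<le> d}"
    unfolding words by (intro finite_imageI finite_lists_length_le fin)
  have "card {w :: 'g letter free_monoid. length (letters w) \<le> d} = (\<Sum>i\<le>d. card (UNIV :: 'g letter set) ^ i)"
    unfolding words by (subst card_image) (auto simp: inj_on_def card_lists_length_le[OF fin, simplified])
  also have "\<dots> \<le> (\<Sum>i\<le>d. (2 * CARD('g)\<^sup>2) ^ i)"
    by (intro sum_mono power_mono q) simp
  also have "\<dots> \<le> (2 * CARD('g)\<^sup>2 + 1) ^ d"
    by (rule sum_power_le)
  finally show "card {w :: 'g letter free_monoid. length (letters w) \<le> d} \<le> (2 * CARD('g)\<^sup>2 + 1) ^ d" .
qed

text \<open>
  The family is indexed by the coordinates of \<open>\<complex>\<^sup>n\<close>, so that polynomials get coordinate vectors.  As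
  the dimension of the space may be smaller than \<open>n\<close>, it is filled up with zeros outside \<open>S\<close>.
\<close>

locale orthonormal_family =
  fixes d :: nat and \<tau> :: "'g::finite ncpoly \<Rightarrow> complex" and S :: "'n::finite set" and b :: "'n \<Rightarrow> 'g ncpoly"
  assumes \<tau>: "strict_state d \<tau>"
    and on: "\<And>k m. k \<in> S \<Longrightarrow> m \<in> S \<Longrightarrow> \<tau> (ncstar (b k) * b m) = of_bool (k = m)"
    and b_zero: "\<And>k. k \<notin> S \<Longrightarrow> b k = 0"
    and b_deg: "\<And>k. b k \<in> polys_upto d"
    and expand: "\<And>p. p \<in> polys_upto d \<Longrightarrow> p - (\<Sum>k\<in>UNIV. cst (\<tau> (ncstar (b k) * p)) * b k) \<in> unitary_ideal"

lemma ex_orthonormal_family: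
  assumes l: "strict_state d (l :: 'g::finite ncpoly \<Rightarrow> complex)"
    and n: "(2 * CARD('g)\<^sup>2 + 1) ^ d \<le> CARD('n::finite)"
  obtains S and b :: "'n::finite \<Rightarrow> 'g::finite ncpoly" where "orthonormal_family d l S b"
proof -
  let ?W = "{w :: 'g letter free_monoid. length (letters w) \<le> d}"
  let ?F = "(\<lambda>w. Poly_Mapping.single w (1::complex)) ` ?W"
  have F0: "finite ?F" "?F \<subseteq> polys_upto d" using finite_short_words by (auto intro: polys_upto_single)
  obtain B where B: "finite B" "card B \<le> card ?F" "B \<subseteq> polys_upto d"
      and on: "\<forall>b\<in>B. \<forall>c\<in>B. l (ncstar b * c) = of_bool (b = c)"
      and F: "\<forall>p\<in>?F. p - expand l B p \<in> unitary_ideal"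
    using gram_schmidt[OF l F0] by blast
  have "card B \<le> CARD('n)"
    by (rule order_trans[OF B(2) order_trans[OF card_image_le[OF finite_short_words]
              order_trans[OF card_short_words n]]])
  then obtain S :: "'n set" where "card S = card B" "finite S"
    by (metis obtain_subset_with_card_n finite)
  then obtain \<beta> where \<beta>: "bij_betw \<beta> S B" using B(1) finite_same_card_bij by metis
  define b where "b k = (if k \<in> S then \<beta> k else 0)" for k
  have expand: "(\<Sum>k\<in>UNIV. cst (l (ncstar (b k) * p)) * b k) = expand l B p" for p
  proof -
    have "(\<Sum>k\<in>UNIV. cst (l (ncstar (b k) * p)) * b k) = (\<Sum>k\<in>S. cst (l (ncstar (\<beta> k) * p)) * \<beta> k)"
      by (intro sum.mono_neutral_cong_right) (auto simp: b_def)
    also have "\<dots> = expand l B p" unfolding expand_def by (rule sum.reindex_bij_betw[OF \<beta>])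
    finally show ?thesis .
  qed
  have all: "p - expand l B p \<in> unitary_ideal" if "p \<in> polys_upto d" for p
  proof -
    have expand_sum: "expand l B (\<Sum>w\<in>T. cst (c w) * q w) = (\<Sum>w\<in>T. cst (c w) * expand l B (q w))" for T c q
    proof -
      have "expand l B (\<Sum>w\<in>T. cst (c w) * q w)
          = (\<Sum>b\<in>B. \<Sum>w\<in>T. cst (c w) * (cst (l (ncstar b * q w)) * b))"
        by (simp add: expand_def sum_distrib_left cst_left_commute[of "ncstar _"] strict_state_sum[OF l]
            strict_stateD(2)[OF l] cst_sum cst_simps(4) sum_distrib_right mult.assoc)
      then show ?thesis by (subst (asm) sum.swap) (simp add: expand_def sum_distrib_left)
    qed
    let ?m = "\<lambda>w. Poly_Mapping.single w (1::complex)"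
    have p: "p = (\<Sum>w\<in>Poly_Mapping.keys p. cst (Poly_Mapping.lookup p w) * ?m w)"
      using poly_mapping_as_sum[of p] by (simp add: cst_mult_single)
    have "p - expand l B p = (\<Sum>w\<in>Poly_Mapping.keys p. cst (Poly_Mapping.lookup p w) * (?m w - expand l B (?m w)))"
      by (subst (1 2) p) (simp only: expand_sum right_diff_distrib sum_subtractf)
    also have "\<dots> \<in> unitary_ideal"
      using that F by (intro ideal_sum ideal_lmult) (auto simp: polys_upto_iff)
    finally show ?thesis .
  qed
  show ?thesis
  proof (rule that[of S b], rule orthonormal_family.intro)
    show "strict_state d l" by (rule l)
    show "l (ncstar (b k) * b m) = of_bool (k = m)" if "k \<in> S" "m \<in> S" for k m
      using that on[rule_format, of "\<beta> k" "\<beta> m"] \<beta> by (auto simp: b_def bij_betw_def inj_on_def)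
    show "b k \<in> polys_upto d" for k
      using B(3) \<beta> by (auto simp: b_def bij_betw_def)
    show "b k = 0" if "k \<notin> S" for k using that by (simp add: b_def)
  qed (simp add: expand all)
qed

section \<open>Partitioned unitaries from strict states\<close>

definition stack :: "('g \<Rightarrow> complex ^ 'n) \<Rightarrow> complex ^ ('g::finite \<times> 'n::finite)"
  where "stack f = (\<chi> p. f (fst p) $ snd p)"

lemma cip_stack: "cip (stack f) (stack h) = (\<Sum>i\<in>UNIV. cip (f i) (h i))"
  unfolding cip_def stack_def UNIV_Times_UNIV[symmetric] sum.cartesian_product
  by (rule sum.cong) auto

lemma cip_delta:
  fixes u v :: "complex ^ 'n::finite"
  shows "(\<Sum>i\<in>(UNIV :: 'g::finite set). cip (if i = j then u else 0) (f i)) = cip u (f j)"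
    "(\<Sum>i\<in>(UNIV :: 'g::finite set). cip (f i) (if i = j then v else 0)) = cip (f j) v"
proof -
  have "(\<Sum>i\<in>(UNIV :: 'g set). cip (if i = j then u else 0) (f i)) = (\<Sum>i\<in>UNIV. if i = j then cip u (f i) else 0)"
    by (rule sum.cong) (auto simp: cip_simps)
  then show "(\<Sum>i\<in>(UNIV :: 'g set). cip (if i = j then u else 0) (f i)) = cip u (f j)" by simp
  have "(\<Sum>i\<in>(UNIV :: 'g set). cip (f i) (if i = j then v else 0)) = (\<Sum>i\<in>UNIV. if i = j then cip (f i) v else 0)"
    by (rule sum.cong) (auto simp: cip_simps)
  then show "(\<Sum>i\<in>(UNIV :: 'g set). cip (f i) (if i = j then v else 0)) = cip (f j) v" by simp
qed

lemma conj_transpose_nth [simp]: "conj_transpose M $ i $ j = cnj (M $ j $ i)"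
  by (simp add: conj_transpose_def map_matrix_def transpose_def)

text \<open>
  Letters are applied one after the other from the right, and before the last one is applied the word has
  length less than \<open>d\<close>, so that the hypothesis applies at every stage.
\<close>

lemma eval_word_GNS:
  assumes letter: "\<And>m w. length (letters w) < d \<Longrightarrow>
      eval_letter A m *v J (Poly_Mapping.single w 1) = J (gen m * Poly_Mapping.single w 1)"
    and "length (letters w) \<le> d"
  shows "eval_word A w *v J 1 = J (Poly_Mapping.single w 1)"
proof -
  have "foldr (\<lambda>m M. eval_letter A m ** M) ls (mat 1) *v J 1 = J (Poly_Mapping.single (Word ls) 1)"
    if "length ls \<le> d" for ls
    using that
  proof (induction ls)
    case Nil
    show ?case by (simp add: zero_free_monoid_def[symmetric])
  next
    case (Cons m ls)
    then show ?case
      using letter[of "Word ls" m]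
      by (simp add: matrix_vector_mul_assoc[symmetric] gen_def mult_single plus_free_monoid_def)
  qed
  from this[of "letters w"] show ?thesis using assms(2) by (simp add: eval_word_def)
qed

lemma mult_vec_sum: "(\<Sum>k\<in>S. M k) *v x = (\<Sum>k\<in>S. M k *v x)" for M :: "_ \<Rightarrow> complex ^ 'n::finite ^ 'm::finite"
  by (induction S rule: infinite_finite_induct) (simp_all add: matrix_vector_mult_add_rdistrib)

lemma map_matrix_mult_vec: "map_matrix ((*) c) M *v x = c *s (M *v x)" for M :: "complex ^ 'n::finite ^ 'm::finite"
  by (simp add: vec_eq_iff matrix_vector_mult_def map_matrix_def sum_distrib_left mult.assoc)

text \<open>
  The Gelfand-Naimark-Segal construction truncated at degree \<open>d\<close>; \<open>J\<close> is the coordinate map.  Left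
  multiplication by the letters determines the unitary only on the vectors that come from words shorter than \<open>d\<close>;
  \<open>unitary_extension\<close> supplies the rest.
\<close>

lemma GNS_representation:
  assumes l: "strict_state d (l :: 'g::finite ncpoly \<Rightarrow> complex)"
    and n: "(2 * CARD('g)\<^sup>2 + 1) ^ d \<le> CARD('n::finite)"
  obtains A :: "'g::finite \<Rightarrow> 'g \<Rightarrow> complex ^ 'n::finite ^ 'n" and J :: "'g ncpoly \<Rightarrow> complex ^ 'n::finite" where
    "A \<in> partitioned_unitaries"
    "\<And>p. p \<in> polys_upto d \<Longrightarrow> eval_poly A p *v J 1 = J p"
    "\<And>p q. p \<in> polys_upto d \<Longrightarrow> q \<in> polys_upto d \<Longrightarrow> cip (J p) (J q) = l (ncstar q * p)"
proof -
  obtain S and b :: "'n \<Rightarrow> 'g ncpoly" where fam: "orthonormal_family d l S b"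
    by (rule ex_orthonormal_family[OF l n])
  note b = orthonormal_family.b_deg[OF fam] and expand = orthonormal_family.expand[OF fam]
  define J :: "'g ncpoly \<Rightarrow> complex ^ 'n" where "J p = (\<chi> k. l (ncstar (b k) * p))" for p
  have J_add: "J (p + q) = J p + J q" and J_cst: "J (cst c * p) = c *s J p" for p q c
    by (simp_all add: J_def vec_eq_iff distrib_left cst_left_commute strict_stateD(1,2)[OF l])
  have J_zero: "J 0 = 0" by (simp add: J_def vec_eq_iff strict_state_zero[OF l])
  have J_sum: "J (sum p T) = (\<Sum>t\<in>T. J (p t))" for p and T :: "'g letter free_monoid set"
    by (induction T rule: infinite_finite_induct) (simp_all add: J_add J_zero)
  have J_ip: "cip (J p) (J q) = l (ncstar q * p)" if "p \<in> polys_upto d" "q \<in> polys_upto d" for p q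
  proof -
    have "l (ncstar q * p) = l (ncstar q * (\<Sum>k\<in>UNIV. cst (l (ncstar (b k) * p)) * b k))"
      using that b
      by (intro strict_state_ideal_right[OF l] expand polys_upto_sum polys_upto_cst_mult)
    also have "\<dots> = (\<Sum>k\<in>UNIV. l (ncstar (b k) * p) * l (ncstar q * b k))"
      unfolding sum_distrib_left strict_state_sum[OF l] cst_left_commute strict_stateD(2)[OF l] ..
    also have "\<dots> = cip (J p) (J q)"
      by (simp add: cip_def J_def strict_state_cnj[OF l, of q])
    finally show ?thesis ..
  qed
  \<comment> \<open>only these words can be multiplied by a letter without leaving the space\<close>
  define W where "W = {w :: 'g letter free_monoid. length (letters w) < d}"
  let ?m = "\<lambda>w. Poly_Mapping.single w (1::complex)"
  have "W \<subseteq> {w. length (letters w) \<le> d}" by (auto simp: W_def)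
  then have finW: "finite W" using finite_short_words by (rule finite_subset)
  have mW: "?m w \<in> polys_upto d" "gen m * ?m w \<in> polys_upto d" if "w \<in> W" for w m
  proof -
    have "?m w \<in> polys_upto (d - 1)" "d = 1 + (d - 1)" using that by (auto simp: W_def intro: polys_upto_single)
    then show "gen m * ?m w \<in> polys_upto d" by (metis polys_upto_mult polys_upto_gen)
  qed (use that in \<open>simp add: W_def polys_upto_single\<close>)
  \<comment> \<open>the relations may be used between two words of length at most \<open>d - 1\<close>, as the total degree is then at most \<open>2d\<close>\<close>
  have mid: "l (ncstar (?m v) * ((\<Sum>i\<in>UNIV. gen (s i) * gen (t i)) * ?m w)) = of_bool c * l (ncstar (?m v) * ?m w)"
    if "v \<in> W" "w \<in> W" "of_bool c - (\<Sum>i\<in>UNIV. gen (s i) * gen (t i)) \<in> unitary_ideal"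
    for v w c and s t :: "'g \<Rightarrow> 'g letter"
  proof -
    let ?u = "of_bool c - (\<Sum>i\<in>UNIV. gen (s i) * gen (t i))"
    have "?u \<in> polys_upto (1 + 1)"
      by (intro polys_upto_diff polys_upto_sum polys_upto_mult polys_upto_gen) simp
    moreover have "?m v \<in> polys_upto (d - 1)" "?m w \<in> polys_upto (d - 1)" "1 \<le> d"
      using that(1,2) by (auto simp: W_def intro: polys_upto_single)
    ultimately have "ncstar (?m v) * (?u * ?m w) \<in> polys_upto ((d - 1) + ((1 + 1) + (d - 1)))"
      by (intro polys_upto_mult polys_upto_ncstar)
    then have "ncstar (?m v) * (?u * ?m w) \<in> polys_upto (2 * d)"
      using \<open>1 \<le> d\<close> by (elim polys_upto_mono) simp
    then have "l (ncstar (?m v) * (?u * ?m w)) = 0"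
      using that(3) by (intro strict_stateD(4)[OF l] ideal_lmult ideal_rmult)
    moreover have "l (- p) = - l p" for p
      using strict_state_diff[OF l, of 0 p] strict_state_zero[OF l] by simp
    ultimately show ?thesis
      by (cases c) (simp_all add: left_diff_distrib right_diff_distrib strict_state_diff[OF l] strict_state_zero[OF l])
  qed
  \<comment> \<open>columns \<open>e\<^sub>j w\<close> are sent to \<open>X e\<^sub>j w\<close> (first case), and \<open>X\<^sup>* e\<^sub>j w\<close> to \<open>e\<^sub>j w\<close> (second case)\<close>
  define x where "x = (\<lambda>(e, j, w). if e then stack (\<lambda>i. if i = j then J (?m w) else 0)
      else stack (\<lambda>i. J (gen (XT j i) * ?m w)))"
  define y where "y = (\<lambda>(e, j, w). if e then stack (\<lambda>i. J (gen (X i j) * ?m w))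
      else stack (\<lambda>i. if i = j then J (?m w) else 0))"
  let ?F = "(UNIV :: bool set) \<times> (UNIV :: 'g set) \<times> W"
  have gram_mixed: "cip (x (True, j, w)) (x (False, k, v)) = cip (y (True, j, w)) (y (False, k, v))"
    if "w \<in> W" "v \<in> W" for j k w v
    using mW that
    by (simp add: x_def y_def cip_stack cip_delta J_ip ncstar_mult ncstar_gen mult.assoc)
  have gram: "cip (x i) (x j) = cip (y i) (y j)" if "i \<in> ?F" "j \<in> ?F" for i j
  proof -
    obtain e a w e' c v where i: "i = (e, a, w)" and j: "j = (e', c, v)" by (metis prod_cases3)
    have W: "w \<in> W" "v \<in> W" using that i j by auto
    consider "e" "e'" | "\<not> e" "\<not> e'" | "e" "\<not> e'" | "\<not> e" "e'" by blast
    then show ?thesis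
    proof cases
      case 1
      have "cip (y i) (y j) = l (ncstar (?m v) * ((\<Sum>k\<in>UNIV. gen (XT k c) * gen (X k a)) * ?m w))"
        using 1 mW W
        by (simp add: i j y_def cip_stack J_ip ncstar_mult ncstar_gen strict_state_sum[OF l, symmetric]
            sum_distrib_left sum_distrib_right mult.assoc)
      also have "\<dots> = of_bool (c = a) * l (ncstar (?m v) * ?m w)"
        by (rule mid[OF W(2,1) ideal_XT_X])
      also have "\<dots> = cip (x i) (x j)"
        using 1 mW W by (auto simp: i j x_def cip_stack cip_delta J_ip cip_simps)
      finally show ?thesis ..
    next
      case 2
      have "cip (x i) (x j) = l (ncstar (?m v) * ((\<Sum>k\<in>UNIV. gen (X c k) * gen (XT a k)) * ?m w))"
        using 2 mW W
        by (simp add: i j x_def cip_stack J_ip ncstar_mult ncstar_gen strict_state_sum[OF l, symmetric]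
            sum_distrib_left sum_distrib_right mult.assoc)
      also have "\<dots> = of_bool (c = a) * l (ncstar (?m v) * ?m w)"
        by (rule mid[OF W(2,1) ideal_X_XT])
      also have "\<dots> = cip (y i) (y j)"
        using 2 mW W by (auto simp: i j y_def cip_stack cip_delta J_ip cip_simps)
      finally show ?thesis .
    next
      case 3
      then show ?thesis using gram_mixed W i j by simp
    next
      case 4
      then show ?thesis using gram_mixed[of v w c a] W i j cip_cnj by metis
    qed
  qed
  have "finite ?F" using finW by simp
  then have "\<exists>U. isometry U \<and> (\<forall>i\<in>?F. U *v x i = y i)"
    by (rule unitary_extension) (rule gram)
  then obtain U where U: "isometry U" "\<And>i. i \<in> ?F \<Longrightarrow> U *v x i = y i"
    by (elim exE conjE) (rule that, assumption, erule bspec, assumption)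
  define A :: "'g \<Rightarrow> 'g \<Rightarrow> complex ^ 'n ^ 'n" where "A i j = (\<chi> a c. U $ (i, a) $ (j, c))" for i j
  have block: "block_matrix A = U" by (simp add: block_matrix_def A_def vec_eq_iff)
  have A: "A \<in> partitioned_unitaries"
    using isometry_unitary[OF U(1)] by (simp add: partitioned_unitaries_def block)
  have sum_col: "(\<Sum>p\<in>UNIV. g p * stack (\<lambda>i. if i = j then v else 0) $ p) = (\<Sum>c\<in>UNIV. g (j, c) * v $ c)"
    for g :: "'g \<times> 'n \<Rightarrow> complex" and v j
  proof -
    have "(\<Sum>p\<in>UNIV. g p * stack (\<lambda>i. if i = j then v else 0) $ p)
        = (\<Sum>i\<in>UNIV. \<Sum>c\<in>UNIV. if i = j then g (i, c) * v $ c else 0)"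
      unfolding UNIV_Times_UNIV[symmetric] sum.cartesian_product
      by (rule sum.cong) (auto simp: stack_def)
    then show ?thesis by (subst (asm) sum.swap) simp
  qed
  have "eval_letter A m *v J (?m w) = J (gen m * ?m w)" if "w \<in> W" for m w
  proof (cases m)
    case (X i j)
    have "U *v stack (\<lambda>i. if i = j then J (?m w) else 0) = stack (\<lambda>i. J (gen (X i j) * ?m w))"
      using U(2)[of "(True, j, w)"] that by (simp add: x_def y_def)
    then have "(U *v stack (\<lambda>i. if i = j then J (?m w) else 0)) $ (i, a) = J (gen (X i j) * ?m w) $ a" for a
      by (simp add: stack_def)
    then show ?thesis
      by (simp add: X vec_eq_iff matrix_vector_mult_def sum_col A_def)
  next
    case (XT i j)
    have "U *v stack (\<lambda>j. J (gen (XT i j) * ?m w)) = stack (\<lambda>k. if k = i then J (?m w) else 0)"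
      using U(2)[of "(False, i, w)"] that by (simp add: x_def y_def)
    then have "conj_transpose U *v stack (\<lambda>k. if k = i then J (?m w) else 0) = stack (\<lambda>j. J (gen (XT i j) * ?m w))"
      using isometry_unitary[OF U(1)] by (metis matrix_vector_mul_assoc matrix_vector_mul_lid)
    then have "(conj_transpose U *v stack (\<lambda>k. if k = i then J (?m w) else 0)) $ (j, a) = J (gen (XT i j) * ?m w) $ a" for a
      by (simp add: stack_def)
    then show ?thesis
      by (simp add: XT vec_eq_iff matrix_vector_mult_def sum_col A_def)
  qed
  then have word: "eval_word A w *v J 1 = J (?m w)" if "length (letters w) \<le> d" for w
    using that by (intro eval_word_GNS[where d=d]) (simp add: W_def)
  have "eval_poly A p *v J 1 = J p" if "p \<in> polys_upto d" for p
  proof -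
    have "eval_poly A p *v J 1 = (\<Sum>w\<in>Poly_Mapping.keys p. Poly_Mapping.lookup p w *s J (?m w))"
      unfolding eval_poly_def mult_vec_sum map_matrix_mult_vec
      using that word by (intro sum.cong) (auto simp: polys_upto_iff)
    also have "\<dots> = J (\<Sum>w\<in>Poly_Mapping.keys p. cst (Poly_Mapping.lookup p w) * ?m w)"
      by (simp only: J_sum J_cst)
    also have "\<dots> = J p"
      using poly_mapping_as_sum[of p] by (simp add: cst_mult_single)
    finally show ?thesis .
  qed
  with A J_ip show ?thesis by (intro that[of A J])
qed

section \<open>Evaluation and the involution\<close>

lemma conj_transpose_mult:
  fixes M :: "complex ^ 'b::finite ^ 'a::finite" and N :: "complex ^ 'c::finite ^ 'b"
  shows "conj_transpose (M ** N) = conj_transpose N ** conj_transpose M"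
  by (simp add: vec_eq_iff matrix_matrix_mult_def mult.commute)

lemma eval_word_star:
  fixes A :: "'g \<Rightarrow> 'g \<Rightarrow> complex ^ 'n::finite ^ 'n"
  shows "eval_word A (star_word w) = conj_transpose (eval_word A w)"
proof -
  let ?E = "\<lambda>ls M. foldr (\<lambda>l M. eval_letter A l ** M) ls M"
  have pull: "?E ls M = ?E ls (mat 1) ** M" for ls M
    by (induction ls) (simp_all add: matrix_mul_assoc)
  have letter: "eval_letter A (star_letter l) = conj_transpose (eval_letter A l)" for l
    by (cases l) (simp_all add: vec_eq_iff)
  have one: "conj_transpose (mat 1) = (mat 1 :: complex ^ 'n ^ 'n)"
    by (simp add: vec_eq_iff mat_def)
  have "?E (rev (map star_letter ls)) (mat 1) = conj_transpose (?E ls (mat 1))" for ls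
  proof (induction ls)
    case (Cons l ls)
    have "?E (rev (map star_letter (l # ls))) (mat 1)
        = ?E (rev (map star_letter ls)) (mat 1) ** eval_letter A (star_letter l)"
      using pull[of "rev (map star_letter ls)" "eval_letter A (star_letter l)"] by simp
    then show ?case by (simp only: Cons letter conj_transpose_mult foldr.simps o_apply)
  qed (simp add: one)
  then show ?thesis by (simp add: eval_word_def star_word_def)
qed

lemma eval_poly_ncstar:
  fixes A :: "'g \<Rightarrow> 'g \<Rightarrow> complex ^ 'n::finite ^ 'n"
  shows "eval_poly A (ncstar p) = conj_transpose (eval_poly A p)"
proof -
  have add: "eval_poly A (p + q) = eval_poly A p + eval_poly A q" for p q
    unfolding eval_poly_def
    by (rule setsum_keys_plus_distrib) (simp_all add: vec_eq_iff map_matrix_def distrib_right)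
  have single: "eval_poly A (Poly_Mapping.single w c) = map_matrix ((*) c) (eval_word A w)" for w c
    by (simp add: eval_poly_def vec_eq_iff map_matrix_def)
  show ?thesis
    by (induction p rule: poly_mapping_additive_induct)
      (simp_all add: ncstar_single ncstar_add single add eval_word_star vec_eq_iff map_matrix_def)
qed

text \<open>
  In the model of any strict state, \<open>f\<close> and its adjoint have the same matrix and hence the same vector
  \<open>J f = J (ncstar f)\<close>, so their difference has square norm zero.
\<close>

lemma hermitian_mod_ideal:
  fixes f :: "'g::finite ncpoly"
  assumes n: "(2 * CARD('g)\<^sup>2 + 1) ^ d \<le> CARD('n::finite)" and f: "f \<in> polys_upto d"
    and pos: "positive_on (partitioned_unitaries :: ('g \<Rightarrow> 'g \<Rightarrow> complex ^ 'n ^ 'n) set) f"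
  shows "f - ncstar f \<in> unitary_ideal"
proof (rule ccontr)
  assume no: "f - ncstar f \<notin> unitary_ideal"
  obtain \<tau> :: "'g ncpoly \<Rightarrow> complex" where \<tau>: "strict_state d \<tau>" using ex_strict_state by blast
  obtain A :: "'g \<Rightarrow> 'g \<Rightarrow> complex ^ 'n ^ 'n" and J :: "'g ncpoly \<Rightarrow> complex ^ 'n" where
    A: "A \<in> partitioned_unitaries"
    and J: "\<And>p. p \<in> polys_upto d \<Longrightarrow> eval_poly A p *v J 1 = J p"
    and ip: "\<And>p q. p \<in> polys_upto d \<Longrightarrow> q \<in> polys_upto d \<Longrightarrow> cip (J p) (J q) = \<tau> (ncstar q * p)"
    by (rule GNS_representation[OF \<tau> n]) (rule that)
  have fs: "ncstar f \<in> polys_upto d" using f by (rule polys_upto_ncstar)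
  have "eval_poly A (ncstar f) = eval_poly A f"
    using pos A by (simp add: positive_on_def psd_def eval_poly_ncstar)
  then have "J f = J (ncstar f)" using J[OF f] J[OF fs] by simp
  then have "0 = cip (J f - J (ncstar f)) (J f - J (ncstar f))" by (simp add: cip_simps)
  also have "\<dots> = \<tau> (ncstar (f - ncstar f) * (f - ncstar f))"
    unfolding cip_simps ip[OF f f] ip[OF f fs] ip[OF fs f] ip[OF fs fs]
    by (simp add: ncstar_diff right_diff_distrib left_diff_distrib strict_state_diff[OF \<tau>])
  finally show False
    using strict_stateD(5)[OF \<tau> polys_upto_diff[OF f fs] no] by simp
qed

section \<open>Separation\<close>

lemma sos_cone_zero: "0 \<in> sos_cone d"
  unfolding sos_cone_def by (rule hull_inc) (auto intro!: exI[of _ 0])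

lemma sos_cone_scaleR:
  assumes q: "q \<in> sos_cone d" and r: "0 \<le> r"
  shows "r *\<^sub>R q \<in> sos_cone d"
proof -
  let ?Q = "{ncstar p * p | p. p \<in> polys_upto d}"
  have "r *\<^sub>R x \<in> ?Q" if "x \<in> ?Q" for x
  proof -
    obtain p where p: "x = ncstar p * p" "p \<in> polys_upto d" using \<open>x \<in> ?Q\<close> by blast
    let ?s = "complex_of_real (sqrt r)"
    have "r *\<^sub>R x = cst (?s * ?s) * (ncstar p * p)"
      using r by (simp add: scaleR_ncpoly p(1) of_real_mult[symmetric] del: of_real_mult)
    also have "\<dots> = ncstar (cst ?s * p) * (cst ?s * p)"
      by (simp add: ncstar_cst_mult cst_simps(4) mult.assoc cst_left_commute[of "ncstar p"])
    finally show ?thesis using polys_upto_cst_mult[OF p(2)] by blast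
  qed
  then have "(\<lambda>x. r *\<^sub>R x) ` ?Q \<subseteq> ?Q" by blast
  then have "convex hull ((\<lambda>x. r *\<^sub>R x) ` ?Q) \<subseteq> convex hull ?Q" by (rule hull_mono)
  moreover have "r *\<^sub>R q \<in> (\<lambda>x. r *\<^sub>R x) ` (convex hull ?Q)"
    using q unfolding sos_cone_def by (rule imageI)
  ultimately show ?thesis
    unfolding sos_cone_def convex_hull_scaling by blast
qed

lemma ideal_scaleR: "p \<in> unitary_ideal \<Longrightarrow> r *\<^sub>R p \<in> unitary_ideal"
  unfolding scaleR_ncpoly by (rule ideal_lmult)

lemma polys_upto_scaleR: "p \<in> polys_upto d \<Longrightarrow> r *\<^sub>R p \<in> polys_upto d"
  unfolding scaleR_ncpoly by (rule polys_upto_cst_mult)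

lemma short_word_split:
  assumes "length (letters w) \<le> 2 * d"
  obtains u v where "u \<in> polys_upto d" "v \<in> polys_upto d" "Poly_Mapping.single w 1 = ncstar u * v"
proof
  let ?u = "Word (take d (letters w))" and ?v = "Word (drop d (letters w))"
  show "Poly_Mapping.single (star_word ?u) 1 \<in> polys_upto d" "Poly_Mapping.single ?v 1 \<in> polys_upto d"
    using assms by (auto intro!: polys_upto_single simp: star_word_def)
  show "Poly_Mapping.single w 1 = ncstar (Poly_Mapping.single (star_word ?u) 1) * Poly_Mapping.single ?v 1"
    by (simp add: ncstar_single mult_single plus_free_monoid_def)
qed

context orthonormal_family
begin

definition coords :: "'g ncpoly \<Rightarrow> complex ^ 'n"
  where "coords p = (\<chi> k. \<tau> (ncstar (b k) * p))"

definition comb :: "complex ^ 'n \<Rightarrow> 'g ncpoly"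
  where "comb x = (\<Sum>k\<in>UNIV. cst (x $ k) * b k)"

definition outer :: "complex ^ 'n \<Rightarrow> complex ^ 'n \<Rightarrow> complex ^ 'n ^ 'n"
  where "outer x y = (\<chi> k m. cnj (x $ k) * y $ m)"

definition gram_poly :: "complex ^ 'n ^ 'n \<Rightarrow> 'g ncpoly"
  where "gram_poly G = (\<Sum>k\<in>UNIV. \<Sum>m\<in>UNIV. cst (G $ k $ m) * (ncstar (b k) * b m))"

definition null_mats :: "(complex ^ 'n ^ 'n) set"
  where "null_mats = {G. gram_poly G \<in> unitary_ideal}"

lemma gram_poly_outer: "gram_poly (outer x y) = ncstar (comb x) * comb y"
  by (simp add: gram_poly_def outer_def comb_def ncstar_sum ncstar_cst_mult sum_product cst_simps(4)
      mult.assoc cst_left_commute[of "ncstar _"])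

lemma comb_coords: "p \<in> polys_upto d \<Longrightarrow> p - comb (coords p) \<in> unitary_ideal"
  using expand by (simp add: comb_def coords_def)

lemma comb_deg: "comb x \<in> polys_upto d"
  unfolding comb_def by (intro polys_upto_sum polys_upto_cst_mult b_deg)

text \<open>
  Each factor may be replaced by its expansion in the basis, since the ideal is two-sided and
  closed under the involution.
\<close>

lemma gram_poly_represents:
  assumes "p \<in> polys_upto d" "q \<in> polys_upto d"
  shows "gram_poly (outer (coords p) (coords q)) - ncstar p * q \<in> unitary_ideal"
proof -
  let ?p = "comb (coords p)" and ?q = "comb (coords q)"
  have "ncstar p * q - ncstar ?p * ?q = ncstar (p - ?p) * q + ncstar ?p * (q - ?q)"
    by (simp add: ncstar_diff algebra_simps)
  also have "\<dots> \<in> unitary_ideal"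
    using assms by (intro ideal_add ideal_lmult ideal_rmult ideal_ncstar comb_coords)
  finally show ?thesis
    using ideal_uminus by (fastforce simp: gram_poly_outer)
qed

lemma gram_poly_add: "gram_poly (G + H) = gram_poly G + gram_poly H"
  by (simp add: gram_poly_def cst_simps(3) distrib_right sum.distrib)

lemma gram_poly_cmult: "gram_poly (map_matrix ((*) c) G) = cst c * gram_poly G"
  by (simp add: gram_poly_def map_matrix_def cst_simps(4) sum_distrib_left mult.assoc)

lemma gram_poly_scaleR: "gram_poly (r *\<^sub>R G) = r *\<^sub>R gram_poly G"
proof -
  have "r *\<^sub>R G = map_matrix ((*) (of_real r)) G"
    by (simp add: vec_eq_iff map_matrix_def scaleR_conv_of_real[where 'a=complex])
  then show ?thesis by (simp add: gram_poly_cmult scaleR_ncpoly)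
qed

lemma gram_poly_zero: "gram_poly 0 = 0"
  by (simp add: gram_poly_def cst_simps)

lemma gram_poly_sum: "gram_poly (sum G T) = (\<Sum>t\<in>T. gram_poly (G t))"
  by (induction T rule: infinite_finite_induct) (simp_all add: gram_poly_zero gram_poly_add)

lemma subspace_null_mats: "subspace null_mats"
  by (auto simp: subspace_def null_mats_def gram_poly_zero gram_poly_add gram_poly_scaleR
      intro: ideal_add ideal_scaleR)

text \<open>
  The Gram matrices of the squares of unit vectors.  Vectors must be supported on \<open>S\<close>, since
  any other coordinate is a coefficient of \<open>0\<close>.
\<close>

definition rank_ones :: "(complex ^ 'n ^ 'n) set"
  where "rank_ones = (\<lambda>x. outer x x) ` (sphere 0 1 \<inter> {x. \<forall>k\<in>- S. x $ k = 0})"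

lemma compact_rank_ones: "compact rank_ones"
  unfolding rank_ones_def
proof (rule compact_continuous_image)
  show "continuous_on (sphere 0 1 \<inter> {x. \<forall>k\<in>- S. x $ k = 0}) (\<lambda>x. outer x x)"
    unfolding outer_def by (intro continuous_intros continuous_on_vec_lambda)
  have "{x :: complex ^ 'n. \<forall>k\<in>- S. x $ k = 0} = (\<Inter>k\<in>- S. {x. x $ k = 0})" by auto
  also have "closed \<dots>"
    by (intro closed_INT ballI closed_Collect_eq continuous_intros)
  finally show "compact (sphere 0 1 \<inter> {x :: complex ^ 'n. \<forall>k\<in>- S. x $ k = 0})"
    by (intro compact_Int_closed) auto
qed

text \<open>
  Because of this normalisation, the state \<open>\<tau>\<close> has the value \<open>1\<close> on all polynomials in the convex
  hull of the squares of unit vectors; so none of them lies in the ideal.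
\<close>

lemma state_comb:
  assumes "\<forall>k\<in>- S. x $ k = 0"
  shows "\<tau> (ncstar (comb x) * comb x) = of_real ((norm x)\<^sup>2)"
proof -
  have "\<tau> (ncstar (comb x) * comb x)
      = (\<Sum>k\<in>UNIV. \<Sum>m\<in>UNIV. cnj (x $ k) * x $ m * \<tau> (ncstar (b k) * b m))"
    unfolding gram_poly_outer[symmetric] gram_poly_def
    by (simp add: outer_def strict_state_sum[OF \<tau>] strict_stateD(2)[OF \<tau>])
  also have "\<dots> = (\<Sum>k\<in>UNIV. \<Sum>m\<in>UNIV. if k = m then cnj (x $ k) * x $ m else 0)"
  proof (intro sum.cong refl)
    fix k m
    show "cnj (x $ k) * x $ m * \<tau> (ncstar (b k) * b m) = (if k = m then cnj (x $ k) * x $ m else 0)"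
      using assms on[of k m] by (cases "k \<in> S"; cases "m \<in> S") auto
  qed
  also have "\<dots> = (\<Sum>k\<in>UNIV. x $ k * cnj (x $ k))" by (simp add: mult.commute)
  also have "\<dots> = of_real ((norm x)\<^sup>2)"
    by (simp add: complex_norm_square[symmetric] norm_vec_def L2_set_def sum_nonneg)
  finally show ?thesis .
qed

lemma coords_support: "\<forall>k\<in>- S. coords p $ k = 0"
  by (simp add: coords_def b_zero strict_state_zero[OF \<tau>])

lemma outer_scaleR: "outer (r *\<^sub>R x) (r *\<^sub>R x) = r\<^sup>2 *\<^sub>R outer x x"
  by (simp add: outer_def vec_eq_iff power2_eq_square)

text \<open>
  A point of the hull represents \<open>q - u f\<close> with \<open>q\<close> a sum of squares and \<open>\<tau>(q) = 1 - u\<close>.  If it lies in the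
  ideal, then \<open>u = 0\<close> is impossible, because it would give \<open>\<tau>(q) = 1\<close> for an element \<open>q\<close> of the
  ideal.  So \<open>u > 0\<close>, and \<open>f\<close> equals the sum of squares \<open>q / u\<close> modulo the ideal.
\<close>

lemma sos_if_hull_meets_null:
  assumes G: "G \<in> null_mats" "G \<in> convex hull (insert (- F) rank_ones)"
    and F: "gram_poly F - f \<in> unitary_ideal"
  obtains q where "q \<in> sos_cone d" "f - q \<in> unitary_ideal"
proof -
  \<comment> \<open>the representations described above; the degree bound on \<open>q\<close> is what lets \<open>\<tau>\<close> see the ideal\<close>
  define D where "D = {G. \<exists>u q. 0 \<le> u \<and> q \<in> sos_cone d \<and> q \<in> polys_upto (2 * d)
    \<and> Re (\<tau> q) = 1 - u \<and> gram_poly G - (q - u *\<^sub>R f) \<in> unitary_ideal}"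
  have re_scale: "Re (\<tau> (r *\<^sub>R q)) = r * Re (\<tau> q)" for r q
    by (simp add: scaleR_ncpoly strict_stateD(2)[OF \<tau>])
  have "convex D"
    unfolding convex_def
  proof (intro ballI allI impI)
    fix G H and x y :: real
    assume "G \<in> D" "H \<in> D" and xy: "0 \<le> x" "0 \<le> y" "x + y = 1"
    then obtain u q v r where
      q: "0 \<le> u" "q \<in> sos_cone d" "q \<in> polys_upto (2 * d)" "Re (\<tau> q) = 1 - u"
        "gram_poly G - (q - u *\<^sub>R f) \<in> unitary_ideal"
      and r: "0 \<le> v" "r \<in> sos_cone d" "r \<in> polys_upto (2 * d)" "Re (\<tau> r) = 1 - v"
        "gram_poly H - (r - v *\<^sub>R f) \<in> unitary_ideal"
      unfolding D_def by blast
    have "convex (sos_cone d :: 'g ncpoly set)"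
      unfolding sos_cone_def by (rule convex_convex_hull)
    then have "x *\<^sub>R q + y *\<^sub>R r \<in> sos_cone d"
      using q(2) r(2) xy by (rule convexD)
    moreover have "x *\<^sub>R q + y *\<^sub>R r \<in> polys_upto (2 * d)"
      by (intro polys_upto_add polys_upto_scaleR q(3) r(3))
    moreover have "Re (\<tau> (x *\<^sub>R q + y *\<^sub>R r)) = 1 - (x * u + y * v)"
    proof -
      have "Re (\<tau> (x *\<^sub>R q + y *\<^sub>R r)) = (x + y) - (x * u + y * v)"
        by (simp add: strict_stateD(1)[OF \<tau>] re_scale q(4) r(4) algebra_simps)
      then show ?thesis using xy by simp
    qed
    moreover have "gram_poly (x *\<^sub>R G + y *\<^sub>R H) - (x *\<^sub>R q + y *\<^sub>R r - (x * u + y * v) *\<^sub>R f) \<in> unitary_ideal"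
      using ideal_add[OF ideal_scaleR[OF q(5), of x] ideal_scaleR[OF r(5), of y]]
      by (simp add: gram_poly_add gram_poly_scaleR algebra_simps)
    moreover have "0 \<le> x * u + y * v" using xy q(1) r(1) by simp
    ultimately show "x *\<^sub>R G + y *\<^sub>R H \<in> D"
      unfolding D_def by blast
  qed
  moreover have "insert (- F) rank_ones \<subseteq> D"
  proof -
    have "gram_poly (- F) - (0 - 1 *\<^sub>R f) \<in> unitary_ideal"
      using ideal_uminus[OF F] gram_poly_scaleR[of "- 1" F] by simp
    then have "- F \<in> D"
      unfolding D_def using sos_cone_zero strict_state_zero[OF \<tau>]
      by (intro CollectI exI[of _ 1] exI[of _ 0]) simp
    moreover have "outer x x \<in> D" if "norm x = 1" "\<forall>k\<in>- S. x $ k = 0" for x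
    proof -
      let ?q = "ncstar (comb x) * comb x"
      have "?q \<in> sos_cone d"
        unfolding sos_cone_def using comb_deg by (intro hull_inc) blast
      moreover have "?q \<in> polys_upto (2 * d)"
        using polys_upto_mult[OF polys_upto_ncstar[OF comb_deg] comb_deg] by (simp add: mult_2)
      ultimately show ?thesis
        unfolding D_def using state_comb[OF that(2)] that(1)
        by (intro CollectI exI[of _ 0] exI[of _ ?q]) (simp add: gram_poly_outer)
    qed
    ultimately show ?thesis by (auto simp: rank_ones_def)
  qed
  ultimately have "G \<in> D" using G(2) hull_minimal by blast
  then obtain u q where q: "0 \<le> u" "q \<in> sos_cone d" "q \<in> polys_upto (2 * d)" "Re (\<tau> q) = 1 - u"
      "gram_poly G - (q - u *\<^sub>R f) \<in> unitary_ideal"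
    unfolding D_def by blast
  have I: "q - u *\<^sub>R f \<in> unitary_ideal"
    using ideal_diff[OF _ q(5)] G(1) by (fastforce simp: null_mats_def)
  have "u \<noteq> 0"
  proof
    assume "u = 0"
    then have "\<tau> q = 0" using I q(3) by (intro strict_stateD(4)[OF \<tau>]) simp_all
    then show False using q(4) \<open>u = 0\<close> by simp
  qed
  show thesis
  proof (rule that)
    show "(1 / u) *\<^sub>R q \<in> sos_cone d" using q(1,2) by (intro sos_cone_scaleR) simp_all
    have "(- 1 / u) *\<^sub>R (q - u *\<^sub>R f) = f - (1 / u) *\<^sub>R q"
      using \<open>u \<noteq> 0\<close> by (simp add: scaleR_diff_right)
    then show "f - (1 / u) *\<^sub>R q \<in> unitary_ideal" using ideal_scaleR[OF I, of "- 1 / u"] by simp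
  qed
qed

text \<open>
  Strict separation gives a matrix \<open>a\<close> that is orthogonal to the subspace, positive on the rank one
  matrices and negative at \<open>F\<close>.  Being orthogonal to the subspace, it defines a functional on polynomials of
  degree at most \<open>2d\<close> modulo the ideal.  This functional need not be Hermitian, so it is averaged with its
  adjoint; this does not change its real part on Hermitian elements, in particular on squares and,
  modulo the ideal, on \<open>f\<close>.
\<close>

lemma state_if_hull_avoids_null:
  assumes disj: "null_mats \<inter> convex hull (insert (- F) rank_ones) = {}"
    and F: "gram_poly F - f \<in> unitary_ideal" and f: "f \<in> polys_upto d" "f - ncstar f \<in> unitary_ideal"
  obtains l where "strict_state d l" "Re (l f) < 0"
proof -
  have "compact (convex hull (insert (- F) rank_ones))"
    by (intro compact_convex_hull compact_insert compact_rank_ones)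
  then obtain a \<beta> where null: "\<And>G. G \<in> null_mats \<Longrightarrow> a \<bullet> G < \<beta>"
      and pos: "\<And>G. G \<in> convex hull (insert (- F) rank_ones) \<Longrightarrow> \<beta> < a \<bullet> G"
    using separating_hyperplane_closed_compact[of null_mats "convex hull (insert (- F) rank_ones)"]
      disj subspace_imp_convex[OF subspace_null_mats] closed_subspace[OF subspace_null_mats]
    by (metis convex_convex_hull empty_not_insert hull_subset subset_empty)
  have "0 \<in> null_mats" by (simp add: null_mats_def gram_poly_zero)
  then have \<beta>: "0 < \<beta>" using null by fastforce
  have null0: "a \<bullet> G = 0" if "G \<in> null_mats" for G
  proof (rule ccontr)
    assume "a \<bullet> G \<noteq> 0"
    moreover have "(\<beta> / (a \<bullet> G)) *\<^sub>R G \<in> null_mats"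
      using subspace_null_mats that by (rule subspace_scale)
    ultimately show False using null by fastforce
  qed
  \<comment> \<open>the complex linear functional with real part \<open>a \<bullet> G\<close>\<close>
  define h where "h G = (\<Sum>k\<in>UNIV. \<Sum>m\<in>UNIV. cnj (a $ k $ m) * G $ k $ m)" for G :: "complex ^ 'n ^ 'n"
  have h_add: "h (G + H) = h G + h H" and h_cmult: "h (map_matrix ((*) c) G) = c * h G" for G H c
    by (simp_all add: h_def map_matrix_def distrib_left sum.distrib sum_distrib_left mult.left_commute)
  have h_zero: "h 0 = 0" by (simp add: h_def)
  have h_sum: "h (sum G T) = (\<Sum>t\<in>T. h (G t))" for G and T :: "'g letter free_monoid set"
    by (induction T rule: infinite_finite_induct) (simp_all add: h_zero h_add)
  have Re_h: "Re (h G) = a \<bullet> G" for G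
    by (simp add: h_def inner_vec_def inner_complex_def)
  have h_null: "h G = 0" if "G \<in> null_mats" for G
  proof -
    have "map_matrix ((*) \<i>) G \<in> null_mats"
      using that by (simp add: null_mats_def gram_poly_cmult ideal_lmult)
    from null0[OF this] null0[OF that] show ?thesis
      unfolding Re_h[symmetric] h_cmult by (simp add: complex_eq_iff)
  qed
  have "\<exists>G. gram_poly G - Poly_Mapping.single w 1 \<in> unitary_ideal" if "length (letters w) \<le> 2 * d" for w
    using short_word_split[OF that] gram_poly_represents by metis
  then obtain W where W: "\<And>w. length (letters w) \<le> 2 * d \<Longrightarrow>
      gram_poly (W w) - Poly_Mapping.single w 1 \<in> unitary_ideal"
    by metis
  \<comment> \<open>any choice of Gram matrices for the short words gives the same values on short polynomials\<close>
  define l1 where "l1 = lin (\<lambda>w. h (W w))"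
  have l1: "l1 p = h G" if p: "p \<in> polys_upto (2 * d)" and G: "gram_poly G - p \<in> unitary_ideal" for p G
  proof -
    let ?H = "\<Sum>w\<in>Poly_Mapping.keys p. map_matrix ((*) (Poly_Mapping.lookup p w)) (W w)"
    have "l1 p = h ?H" by (simp add: l1_def lin_def h_sum h_cmult)
    have "gram_poly ?H - p = (\<Sum>w\<in>Poly_Mapping.keys p. cst (Poly_Mapping.lookup p w)
        * (gram_poly (W w) - Poly_Mapping.single w 1))"
      using poly_mapping_as_sum[of p]
      by (simp add: gram_poly_sum gram_poly_cmult right_diff_distrib sum_subtractf cst_mult_single)
    also have "\<dots> \<in> unitary_ideal"
      using p by (intro ideal_sum ideal_lmult W) (simp add: polys_upto_iff)
    finally have "gram_poly G - gram_poly ?H \<in> unitary_ideal"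
      using ideal_diff[OF G] by fastforce
    then have "G + (- 1) *\<^sub>R ?H \<in> null_mats"
      unfolding null_mats_def mem_Collect_eq gram_poly_add gram_poly_scaleR by simp
    moreover have "h (G + (- 1) *\<^sub>R ?H) = h G - h ?H"
      by (simp add: h_def right_diff_distrib sum_subtractf)
    ultimately show ?thesis using h_null \<open>l1 p = h ?H\<close> by simp
  qed
  \<comment> \<open>Hermitian part of the functional\<close>
  define l where "l p = (l1 p + cnj (l1 (ncstar p))) / 2" for p
  have "strict_state d l"
    unfolding strict_state_def
  proof (intro conjI allI ballI)
    show "l (p + q) = l p + l q" for p q
      by (simp add: l_def l1_def ncstar_add lin_add add_divide_distrib)
    show "l (cst c * p) = c * l p" for c p
      by (simp add: l_def l1_def ncstar_cst_mult lin_cst_mult algebra_simps)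
    show "l (ncstar p) = cnj (l p)" for p
      by (simp add: l_def add.commute)
    show "l p = 0" if "p \<in> unitary_ideal \<inter> polys_upto (2 * d)" for p
    proof -
      have "l1 q = 0" if "q \<in> unitary_ideal" "q \<in> polys_upto (2 * d)" for q
        using l1[OF that(2), of 0] ideal_uminus[OF that(1)] by (simp add: gram_poly_zero h_zero)
      then show ?thesis using that by (simp add: l_def ideal_ncstar polys_upto_ncstar)
    qed
    show "0 < Re (l (ncstar p * p))" if p: "p \<in> polys_upto d - unitary_ideal" for p
    proof -
      let ?c = "coords p"
      have deg: "ncstar p * p \<in> polys_upto (2 * d)"
        using p polys_upto_mult[OF polys_upto_ncstar, of p d p d] by (simp add: mult_2)
      have "Re (l (ncstar p * p)) = a \<bullet> outer ?c ?c"
        using l1[OF deg gram_poly_represents[of p p]] p by (simp add: l_def ncstar_mult Re_h)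
      moreover have "?c \<noteq> 0"
        using comb_coords[of p] p by (auto simp: comb_def cst_simps)
      moreover define x where "x = (1 / norm ?c) *\<^sub>R ?c"
      ultimately have x: "norm x = 1" "?c = norm ?c *\<^sub>R x" by simp_all
      have "outer x x \<in> rank_ones"
        unfolding rank_ones_def using x(1) coords_support[of p] by (auto simp: x_def)
      then have "0 < a \<bullet> outer x x" using pos[OF hull_inc] \<beta> by fastforce
      then have "0 < (norm ?c)\<^sup>2 * (a \<bullet> outer x x)" using \<open>?c \<noteq> 0\<close> by simp
      also have "\<dots> = a \<bullet> outer ?c ?c" by (subst (2 3) x(2)) (simp add: outer_scaleR)
      finally show ?thesis using \<open>Re (l (ncstar p * p)) = a \<bullet> outer ?c ?c\<close> by simp
    qed
  qed
  moreover have "Re (l f) < 0"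
  proof -
    have fd: "f \<in> polys_upto (2 * d)" using f(1) by (rule polys_upto_mono) simp
    have "l1 f = h F" by (rule l1[OF fd F])
    moreover have "l1 (ncstar f) = h F"
      by (rule l1[OF polys_upto_ncstar[OF fd] ideal_diff_trans[OF F f(2)]])
    ultimately have "Re (l f) = a \<bullet> F" by (simp add: l_def Re_h)
    moreover have "\<beta> < a \<bullet> (- F)" by (rule pos) (simp add: hull_inc)
    ultimately show ?thesis using \<beta> by simp
  qed
  ultimately show thesis by (rule that)
qed

end

theorem theorem4p15:
  fixes d :: nat
    and f :: "'g::finite ncpoly"
    and Z :: "('g \<Rightarrow> 'g \<Rightarrow> complex ^ 'n::finite ^ 'n) set"
  assumes "1 \<le> d"
    and "CARD('n) = (2 * CARD('g)\<^sup>2 + 1) ^ d"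
    and "Z = partitioned_unitaries"
    and "ncdegree f = d - 1"
    and "positive_on Z f"
  shows "f \<in> sos_cone d + unitary_ideal"
proof -
  have n: "(2 * CARD('g)\<^sup>2 + 1) ^ d \<le> CARD('n)" using assms(2) by simp
  have f: "f \<in> polys_upto d" using assms(4) by (simp add: polys_upto_def)
  have pos: "positive_on (partitioned_unitaries :: ('g \<Rightarrow> 'g \<Rightarrow> complex ^ 'n ^ 'n) set) f"
    using assms(3,5) by simp
  have herm: "f - ncstar f \<in> unitary_ideal" by (rule hermitian_mod_ideal[OF n f pos])
  obtain \<tau> :: "'g ncpoly \<Rightarrow> complex" where \<tau>: "strict_state d \<tau>" using ex_strict_state by blast
  obtain S and b :: "'n \<Rightarrow> 'g ncpoly" where "orthonormal_family d \<tau> S b"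
    by (rule ex_orthonormal_family[OF \<tau> n])
  then interpret orthonormal_family d \<tau> S b .
  define F where "F = outer (coords 1) (coords f)"
  have F: "gram_poly F - f \<in> unitary_ideal"
    using gram_poly_represents[OF polys_upto_one f] by (simp add: F_def)
  show ?thesis
  proof (cases "null_mats \<inter> convex hull (insert (- F) rank_ones) = {}")
    case True
    then obtain l where l: "strict_state d l" "Re (l f) < 0"
      by (rule state_if_hull_avoids_null[OF _ F f herm])
    obtain A :: "'g \<Rightarrow> 'g \<Rightarrow> complex ^ 'n ^ 'n" and J :: "'g ncpoly \<Rightarrow> complex ^ 'n" where
      A: "A \<in> partitioned_unitaries"
      and J: "\<And>p. p \<in> polys_upto d \<Longrightarrow> eval_poly A p *v J 1 = J p"
      and ip: "\<And>p q. p \<in> polys_upto d \<Longrightarrow> q \<in> polys_upto d \<Longrightarrow> cip (J p) (J q) = l (ncstar q * p)"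
      by (rule GNS_representation[OF l(1) n]) (rule that)
    have "0 \<le> Re (\<Sum>r\<in>UNIV. cnj (J 1 $ r) * (eval_poly A f *v J 1) $ r)"
      using pos A by (simp add: positive_on_def psd_def)
    also have "(\<Sum>r\<in>UNIV. cnj (J 1 $ r) * (eval_poly A f *v J 1) $ r) = cip (J f) (J 1)"
      by (simp add: J[OF f] cip_def mult.commute)
    also have "\<dots> = l f" by (simp add: ip f)
    finally show ?thesis using l(2) by simp
  next
    case False
    then obtain G where "G \<in> null_mats" "G \<in> convex hull (insert (- F) rank_ones)" by blast
    then obtain q where q: "q \<in> sos_cone d" "f - q \<in> unitary_ideal"
      by (rule sos_if_hull_meets_null[OF _ _ F])
    then have "q + (f - q) \<in> sos_cone d + unitary_ideal" by (rule set_plus_intro)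
    then show ?thesis by simp
  qed
qed

end
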